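(* In the DCSMD-SW setting described in the context, let the noise assumption, the network assumption, the boundedness assumption and the Bregman assumption hold, with tail parameter $\theta\ge \frac12$. Let the stepsizes be constant, $\alpha_t=1/\sqrt{T}$ for $t=1,2,\dots,T$, and for $\ell\in\mathcal V$ let $\widetilde x_\ell^T=\frac1T\sum_{t=1}^T x_{\ell,t}$. Then for any $\ell\in\mathcal V$ and any $0<\delta<1$, with probability at least $1-\delta$, $$F(\widetilde x_{\ell}^T)-F(x^* )\leq \begin{cases}\mathcal O\left(\Big[\big(\log\frac{T}{\delta}\big)^{2\theta}+\big(\log\frac{1}{\delta}\big)^{2}\Big]\frac{1}{\sqrt{T}}\right), & \frac12\le\theta<1,\\[2mm] \mathcal O\left(\big(\log\frac{T}{\delta}\big)^{2\theta}\frac{1}{\sqrt{T}}\right), & \theta\ge1,\end{cases}$$ where $\mathcal O(\cdot)$ hides a positive constant factor independent of $T$ and $\delta$ (it may depend on the problem, network, noise and initialization data).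
   Context: Setting. $n,m$ are positive integers, $\mathcal V=\{1,\dots,m\}$, $\|\cdot\|$ is an arbitrary norm on $\mathbb R^n$, $\langle\cdot,\cdot\rangle$ the Euclidean inner product, and $\|z\|_*=\sup_{\|u\|\le1}|\langle z,u\rangle|$ the dual norm. $\mathcal X\subset\mathbb R^n$ is closed and convex (possibly unbounded); $f_i,\psi_i:\mathcal X\to\mathbb R$, $i\in\mathcal V$, are convex and possibly nonsmooth; $f=\sum_{i=1}^m f_i$, $\psi=\sum_{i=1}^m\psi_i$, $F=f+\psi$. A point $x^*\in\mathcal X$ with $F(x)\ge F(x^* )$ for all $x\in\mathcal X$ exists and is fixed. Bregman divergence. $D_\Phi(x\|y)=\Phi(x)-\Phi(y)-\langle\nabla\Phi(y),x-y\rangle$ for a distance-generating function $\Phi:\mathcal X\to\mathbb R$. Algorithm (DCSMD-SW). Given $m\times m$ communication matrices $W_t$ with nonnegative entries, edge sets $\mathcal E_t=\{(j,i):[W_t]_{ij}>0\}$, stepsizes $\alpha_t>0$ and deterministic initial points $x_{i,1}\in\mathcal X$ (not depending on $T$), for $t\ge1$ and $i\in\mathcal V$: $$y_{i,t}=\sum_{j=1}^m[W_t]_{ij}x_{j,t},\qquad x_{i,t+1}=\arg\min_{x\in\mathcal X}\Big\{\langle\widehat g_{i,t}^{SW},x\rangle+\tfrac1{\alpha_t}D_\Phi(x\|y_{i,t})+\psi_i(x)\Big\},$$ where $\widehat g_{i,t}^{SW}=g_{i,t}-\xi_{i,t}$, $g_{i,t}\in\partial f_i(x_{i,t})$, $\mathbb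 E[\xi_{i,t}|\mathcal F_{t-1}]=0$, and $\mathcal F_t$ is the $\sigma$-field generated by the entire history of the randomness up to step $t$ (so $x_{i,t},y_{i,t},g_{i,t}$ are $\mathcal F_{t-1}$-measurable). Noise assumption: for some $\theta\ge\frac12$ there is $\kappa>0$ such that $\mathbb E[\exp\{(\|\xi_{i,t}\|_*/\kappa)^{1/\theta}\}\,|\,\mathcal F_{t-1}]\le2$ for all $t\ge1$, $i\in\mathcal V$. Network assumption: (a) each $W_t$ is doubly stochastic; (b) there is an integer $B\ge1$ such that the graph $(\mathcal V,\mathcal E_{kB+1}\cup\dots\cup\mathcal E_{(k+1)B})$ is strongly connected for every $k\ge0$; (c) there is $0<\eta<1$ with $[W_t]_{ii}\ge\eta$ for all $i,t$ and $[W_t]_{ij}\ge\eta$ whenever $(j,i)\in\mathcal E_t$. Boundedness assumption: there is $G>0$ with $\|g\|_*\le G$ for all $x\in\mathcal X$, $g\in\partial f_i(x)$, $i\in\mathcal V$; and there is $G_\psi>0$ such that every $\psi_i$ is convex with $|\psi_i(x)-\psi_i(y)|\le G_\psi\|x-y\|$ on $\mathcal X$. Bregman assumption: $\Phi$ is differentiable and $\sigma_\Phi$-strongly convex ($\sigma_\Phi>0$) with respect to $\|\cdot\|$ on $\mathcal X$, and $D_\Phi(x\|\sum_{j=1}^m a_jy_j)\le\sum_{j=1}^m a_jD_\Phi(x\|y_j)$ for all $x,y_j\in\mathcal X$, $a_j\ge0$, $\sum_{j=1}^m a_j=1$. Convention: the horizon $T$ is an integer with $T\ge10$. *)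

theory Defs
  imports "HOL-Probability.Probability"
begin

(* The type real ^ 'n carries the Euclidean norm; the arbitrary norm is a function N. *)
definition is_norm :: "(real ^ 'n \<Rightarrow> real) \<Rightarrow> bool" where
  "is_norm N \<longleftrightarrow>
     (\<forall>x. 0 \<le> N x) \<and> (\<forall>x. N x = 0 \<longleftrightarrow> x = 0) \<and>
     (\<forall>c x. N (c *\<^sub>R x) = \<bar>c\<bar> * N x) \<and> (\<forall>x y. N (x + y) \<le> N x + N y)"

definition dual_norm :: "(real ^ 'n \<Rightarrow> real) \<Rightarrow> real ^ 'n \<Rightarrow> real" where
  "dual_norm N z = (SUP u\<in>{u. N u \<le> 1}. \<bar>z \<bullet> u\<bar>)"

(* Subdifferential at x of a function with effective domain S.  The domain is a parameter
   because the feasible set and the domain of convexity of a loss may differ: if S has x on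
   its boundary, a nonempty subdifferential at x is unbounded (it absorbs the normal cone of S). *)
definition subdifferential :: "(real ^ 'n) set \<Rightarrow> (real ^ 'n \<Rightarrow> real) \<Rightarrow> real ^ 'n \<Rightarrow> (real ^ 'n) set" where
  "subdifferential S h x = {g. \<forall>z\<in>S. h z \<ge> h x + g \<bullet> (z - x)}"

(* The second argument is a gradient of Phi.  For a gradient relative to a convex set, as in
   bregman_assumption below, the values on that set do not depend on which one is chosen,
   even if the set has empty interior. *)
definition bregman :: "(real ^ 'n \<Rightarrow> real) \<Rightarrow> (real ^ 'n \<Rightarrow> real ^ 'n) \<Rightarrow> real ^ 'n \<Rightarrow> real ^ 'n \<Rightarrow> real" where
  "bregman \<Phi> d\<Phi> x y = \<Phi> x - \<Phi> y - d\<Phi> y \<bullet> (x - y)"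

(* 'm is the set of agents; it only serves as the index set of the convex combinations. *)
definition bregman_assumption ::
  "'m::finite itself \<Rightarrow> (real ^ 'n) set \<Rightarrow> (real ^ 'n \<Rightarrow> real) \<Rightarrow> (real ^ 'n \<Rightarrow> real) \<Rightarrow>
   (real ^ 'n \<Rightarrow> real ^ 'n) \<Rightarrow> real \<Rightarrow> bool" where
  "bregman_assumption _ X N \<Phi> d\<Phi> \<sigma> \<longleftrightarrow>
     0 < \<sigma> \<and>
     (\<forall>y\<in>X. (\<Phi> has_derivative (\<lambda>h. d\<Phi> y \<bullet> h)) (at y within X)) \<and>
     (\<forall>x\<in>X. \<forall>y\<in>X. \<Phi> x \<ge> \<Phi> y + d\<Phi> y \<bullet> (x - y) + \<sigma> / 2 * (N (x - y))\<^sup>2) \<and>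
     (\<forall>x\<in>X. \<forall>(a :: 'm \<Rightarrow> real) y.
        (\<forall>j. y j \<in> X) \<and> (\<forall>j. 0 \<le> a j) \<and> (\<Sum>j\<in>UNIV. a j) = 1 \<longrightarrow>
        bregman \<Phi> d\<Phi> x (\<Sum>j\<in>UNIV. a j *\<^sub>R y j) \<le> (\<Sum>j\<in>UNIV. a j * bregman \<Phi> d\<Phi> x (y j)))"

definition bounded_assumption ::
  "(real ^ 'n) set \<Rightarrow> (real ^ 'n) set \<Rightarrow> (real ^ 'n \<Rightarrow> real) \<Rightarrow> ('m::finite \<Rightarrow> real ^ 'n \<Rightarrow> real) \<Rightarrow>
   ('m \<Rightarrow> real ^ 'n \<Rightarrow> real) \<Rightarrow> real \<Rightarrow> real \<Rightarrow> bool" where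
  "bounded_assumption X S N f \<psi> G G\<psi> \<longleftrightarrow>
     0 < G \<and> 0 < G\<psi> \<and>
     (\<forall>i. \<forall>x\<in>X. \<forall>g\<in>subdifferential S (f i) x. dual_norm N g \<le> G) \<and>
     (\<forall>i. convex_on X (\<psi> i)) \<and>
     (\<forall>i. \<forall>x\<in>X. \<forall>y\<in>X. \<bar>\<psi> i x - \<psi> i y\<bar> \<le> G\<psi> * N (x - y))"

definition doubly_stochastic :: "real ^ 'm ^ 'm \<Rightarrow> bool" where
  "doubly_stochastic A \<longleftrightarrow>
     (\<forall>i j. 0 \<le> A $ i $ j) \<and> (\<forall>i. (\<Sum>j\<in>UNIV. A $ i $ j) = 1) \<and> (\<forall>j. (\<Sum>i\<in>UNIV. A $ i $ j) = 1)"

definition comm_edges :: "real ^ 'm ^ 'm \<Rightarrow> ('m \<times> 'm) set" where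
  "comm_edges A = {(j, i). 0 < A $ i $ j}"

definition network_assumption :: "(nat \<Rightarrow> real ^ 'm ^ 'm) \<Rightarrow> nat \<Rightarrow> real \<Rightarrow> bool" where
  "network_assumption W B \<eta> \<longleftrightarrow>
     (\<forall>t\<ge>1. doubly_stochastic (W t)) \<and>
     1 \<le> B \<and> (\<forall>k. \<forall>i j. (i, j) \<in> (\<Union>t\<in>{k * B + 1..(k + 1) * B}. comm_edges (W t))\<^sup>*) \<and>
     0 < \<eta> \<and> \<eta> < 1 \<and>
     (\<forall>t\<ge>1. \<forall>i. \<eta> \<le> W t $ i $ i) \<and>
     (\<forall>t\<ge>1. \<forall>i j. (j, i) \<in> comm_edges (W t) \<longrightarrow> \<eta> \<le> W t $ i $ j)"

(* The left-hand side is the conditional expectation of a nonnegative function, with values in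
   the extended nonnegative reals, so no integrability is presupposed. *)
definition noise_assumption ::
  "'w measure \<Rightarrow> (nat \<Rightarrow> 'w measure) \<Rightarrow> (real ^ 'n \<Rightarrow> real) \<Rightarrow> ('m::finite \<Rightarrow> nat \<Rightarrow> 'w \<Rightarrow> real ^ 'n) \<Rightarrow>
   real \<Rightarrow> real \<Rightarrow> bool" where
  "noise_assumption M Fil N \<xi> \<theta> \<kappa> \<longleftrightarrow>
     (\<forall>i. \<forall>t\<ge>1. AE \<omega> in M.
        nn_cond_exp M (Fil (t - 1))
          (\<lambda>\<omega>. ennreal (exp ((dual_norm N (\<xi> i t \<omega>) / \<kappa>) powr (1 / \<theta>)))) \<omega> \<le> 2)"

definition mixed :: "(nat \<Rightarrow> real ^ 'm ^ 'm) \<Rightarrow> ('m::finite \<Rightarrow> nat \<Rightarrow> 'w \<Rightarrow> real ^ 'n) \<Rightarrow>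
    'm \<Rightarrow> nat \<Rightarrow> 'w \<Rightarrow> real ^ 'n" where
  "mixed W x i t \<omega> = (\<Sum>j\<in>UNIV. (W t $ i $ j) *\<^sub>R x j t \<omega>)"

(* x, g and \<xi> form a run of the algorithm on M with stepsizes \<alpha> and initial points x1.  Fil is the
   history: any filtration for which \<xi> is adapted and x, g are predictable (the mixed points
   then are predictable too).  The noise has conditional mean zero componentwise. *)
definition dcsmd_sw_run ::
  "(real ^ 'n) set \<Rightarrow> (real ^ 'n) set \<Rightarrow> ('m::finite \<Rightarrow> real ^ 'n \<Rightarrow> real) \<Rightarrow>
   ('m \<Rightarrow> real ^ 'n \<Rightarrow> real) \<Rightarrow> (real ^ 'n \<Rightarrow> real) \<Rightarrow> (real ^ 'n \<Rightarrow> real ^ 'n) \<Rightarrow>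
   (nat \<Rightarrow> real ^ 'm ^ 'm) \<Rightarrow> ('m \<Rightarrow> real ^ 'n) \<Rightarrow> (nat \<Rightarrow> real) \<Rightarrow>
   'w measure \<Rightarrow> (nat \<Rightarrow> 'w measure) \<Rightarrow> ('m \<Rightarrow> nat \<Rightarrow> 'w \<Rightarrow> real ^ 'n) \<Rightarrow>
   ('m \<Rightarrow> nat \<Rightarrow> 'w \<Rightarrow> real ^ 'n) \<Rightarrow> ('m \<Rightarrow> nat \<Rightarrow> 'w \<Rightarrow> real ^ 'n) \<Rightarrow> bool" where
  "dcsmd_sw_run X S f \<psi> \<Phi> d\<Phi> W x1 \<alpha> M Fil x g \<xi> \<longleftrightarrow>
     prob_space M \<and> filtration (space M) Fil \<and> (\<forall>t. subalgebra M (Fil t)) \<and>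
     (\<forall>i. \<forall>t\<ge>1. x i t \<in> borel_measurable (Fil (t - 1)) \<and>
                g i t \<in> borel_measurable (Fil (t - 1)) \<and>
                \<xi> i t \<in> borel_measurable (Fil t)) \<and>
     (\<forall>i. \<forall>t\<ge>1. \<forall>k. AE \<omega> in M. real_cond_exp M (Fil (t - 1)) (\<lambda>\<omega>. \<xi> i t \<omega> $ k) \<omega> = 0) \<and>
     (\<forall>\<omega>\<in>space M. \<forall>i. x i 1 \<omega> = x1 i) \<and>
     (\<forall>\<omega>\<in>space M. \<forall>i. \<forall>t\<ge>1. g i t \<omega> \<in> subdifferential S (f i) (x i t \<omega>)) \<and>
     (\<forall>\<omega>\<in>space M. \<forall>i. \<forall>t\<ge>1.
        is_arg_min
          (\<lambda>z. (g i t \<omega> - \<xi> i t \<omega>) \<bullet> z + 1 / \<alpha> t * bregman \<Phi> d\<Phi> z (mixed W x i t \<omega>) + \<psi> i z)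
          (\<lambda>z. z \<in> X) (x i (t + 1) \<omega>))"

end

theory Submission
  imports Defs
begin

text \<open>
  Let \<open>A\<^sub>t\<close> be the sum over the agents of the Bregman divergences from the minimizer to \<open>x\<^sub>i\<^sub>,\<^sub>t\<close>.  The optimality
  condition of a mirror step, double stochasticity of the mixing weights and convexity of the Bregman divergence
  in its second argument give, with step size \<open>\<alpha> = 1 / sqrt T\<close> and for any agent \<open>l\<close>, the energy inequality
  \<open>A\<^bsub>t+1\<^esub> + \<alpha> (F x\<^sub>l\<^sub>,\<^sub>t - F x\<^sup>*) \<le> A\<^sub>t + \<alpha> \<Sum>\<^sub>i \<langle>\<xi>\<^sub>i\<^sub>,\<^sub>t, y\<^sub>i\<^sub>,\<^sub>t - x\<^sup>*\<rangle> + E\<^sub>t\<close> (\<open>energy_inequality\<close>).  The error \<open>E\<^sub>t\<close> collects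
  \<open>\<alpha>\<^sup>2\<close> times squared noise norms and \<open>\<alpha>\<close> times the disagreement of the agents.  Disagreement contracts geometrically,
  so its sum over time is at most a constant times the initial disagreement plus all step lengths (\<open>consensus_spread_sum\<close>).  If all noise
  norms stay below \<open>b \<approx> log (T / \<delta>) powr \<theta>\<close>, the errors therefore add up to \<open>O(b\<^sup>2)\<close>, independently of the number of steps.

  The linear noise term is a martingale whose increments scale with \<open>y\<^sub>i\<^sub>,\<^sub>t - x\<^sup>*\<close>, which is not bounded a priori.
  Fix a radius \<open>K\<close> and stop the noise as soon as a mixed point is too far away for the energy to be at most \<open>K\<^sup>2\<close>.  Truncated at the level \<open>b\<close>,
  the stopped martingale has exponential moments (\<open>truncated_exp_le\<close>, \<open>truncated_exp_martingale\<close>) and is, with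
  probability at least \<open>1 - \<delta>\<close>, at most \<open>J K\<close>, where \<open>J\<close> is of order \<open>1 + log (1 / \<delta>)\<close> for \<open>\<theta> < 1\<close> and of order \<open>log (T / \<delta>) powr \<theta>\<close>
  otherwise.  The bound is linear in \<open>K\<close>, while the energy that it has to keep in check is quadratic: for \<open>K\<close> of the
  order of \<open>J + b\<close> the energy inequality shows that the stopping never takes effect
  (\<open>stopped_noise_bound_imp_no_exit\<close>).  Hence \<open>\<alpha> \<Sum>\<^sub>t (F x\<^sub>l\<^sub>,\<^sub>t - F x\<^sup>*) \<le> K\<^sup>2\<close>, and convexity turns this into the
  bound \<open>K\<^sup>2 / sqrt T\<close> for the averaged iterate; \<open>rate_bound\<close> computes the order of \<open>K\<^sup>2\<close>.

  Two points need care because the losses live on a larger domain \<open>S\<close>.  Comparing \<open>f\<^sub>i\<close> at the iterates of different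
  agents requires subgradients at iterates of other agents, and the measurability of the event in question rests on the
  continuity of \<open>F\<close> at the average.  Both follow because a bounded, nonempty subdifferential exists only in the interior of
  \<open>S\<close> (\<open>bounded_subdifferential_imp_interior\<close>), and every iterate carries a subgradient.
\<close>

section \<open>Norms and dual norms\<close>

lemma
  assumes "is_norm N"
  shows is_norm_nonneg: "0 \<le> N x"
    and is_norm_eq_0_iff: "N x = 0 \<longleftrightarrow> x = 0"
    and is_norm_scaleR: "N (c *\<^sub>R x) = \<bar>c\<bar> * N x"
    and is_norm_triangle: "N (x + y) \<le> N x + N y"
  using assms unfolding is_norm_def by auto

lemma is_norm_zero: "is_norm N \<Longrightarrow> N 0 = 0"
  by (simp add: is_norm_eq_0_iff)

lemma is_norm_minus: "is_norm N \<Longrightarrow> N (- x) = N x"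
  using is_norm_scaleR[of N "-1" x] by simp

lemma is_norm_minus_commute: "is_norm N \<Longrightarrow> N (x - y) = N (y - x)"
  using is_norm_minus[of N "x - y"] by simp

lemma is_norm_triangle_via: "is_norm N \<Longrightarrow> N (x - z) \<le> N (x - y) + N (y - z)"
  using is_norm_triangle[of N "x - y" "y - z"] by simp

lemma is_norm_sum_le:
  assumes "is_norm N" "finite I"
  shows "N (\<Sum>i\<in>I. v i) \<le> (\<Sum>i\<in>I. N (v i))"
  using assms(2)
proof (induction I rule: finite_induct)
  case empty
  then show ?case by (simp add: is_norm_zero[OF assms(1)])
next
  case (insert i I)
  then show ?case using is_norm_triangle[OF assms(1), of "v i" "\<Sum>i\<in>I. v i"] by simp
qed

lemma is_norm_le_norm:
  fixes N :: "real ^ 'n \<Rightarrow> real"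
  assumes "is_norm N"
  shows "N x \<le> (\<Sum>k\<in>UNIV. N (axis k 1)) * norm x"
proof -
  have "N x = N (\<Sum>k\<in>UNIV. (x $ k) *\<^sub>R axis k 1)"
    by (simp add: basis_expansion flip: scalar_mult_eq_scaleR)
  also have "\<dots> \<le> (\<Sum>k\<in>UNIV. N ((x $ k) *\<^sub>R axis k 1))"
    by (rule is_norm_sum_le[OF assms]) simp
  also have "\<dots> \<le> (\<Sum>k\<in>UNIV. norm x * N (axis k 1))"
    by (intro sum_mono)
      (simp add: is_norm_scaleR[OF assms] mult_right_mono component_le_norm_cart is_norm_nonneg[OF assms])
  finally show ?thesis by (simp add: sum_distrib_left mult.commute)
qed

lemma continuous_on_is_norm:
  fixes N :: "real ^ 'n \<Rightarrow> real"
  assumes "is_norm N"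
  shows "continuous_on A N"
proof -
  define L where "L = (\<Sum>k\<in>UNIV. N (axis k (1::real)))"
  have "L-lipschitz_on A N"
  proof (rule lipschitz_onI)
    fix x y
    have "N (x - y) \<le> L * norm (x - y)" unfolding L_def by (rule is_norm_le_norm[OF assms])
    moreover have "N x \<le> N (x - y) + N y" "N y \<le> N (x - y) + N x"
      using is_norm_triangle[OF assms, of "x - y" y] is_norm_triangle[OF assms, of "y - x" x]
        is_norm_minus_commute[OF assms, of x y] by auto
    ultimately show "dist (N x) (N y) \<le> L * dist x y" by (simp add: dist_norm)
  qed (auto simp: L_def intro!: sum_nonneg is_norm_nonneg[OF assms])
  then show ?thesis by (rule lipschitz_on_continuous_on)
qed

lemma borel_measurable_is_norm:
  fixes N :: "real ^ 'n \<Rightarrow> real"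
  assumes "is_norm N"
  shows "N \<in> borel_measurable borel"
  by (rule borel_measurable_continuous_onI[OF continuous_on_is_norm[OF assms]])

lemma norm_le_is_norm:
  fixes N :: "real ^ 'n \<Rightarrow> real"
  assumes "is_norm N"
  obtains c where "c > 0" "\<And>x. norm x \<le> c * N x"
proof -
  have "compact (sphere (0 :: real ^ 'n) 1)" by simp
  moreover have "sphere (0 :: real ^ 'n) 1 \<noteq> {}" by simp
  ultimately obtain u where u: "u \<in> sphere 0 1" "\<And>v. v \<in> sphere 0 1 \<Longrightarrow> N u \<le> N v"
    using continuous_attains_inf[OF _ _ continuous_on_is_norm[OF assms]] by metis
  have "u \<noteq> 0" using u(1) by auto
  then have pos: "N u > 0"
    using is_norm_nonneg[OF assms, of u] is_norm_eq_0_iff[OF assms, of u] by linarith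
  have "norm x \<le> (1 / N u) * N x" for x
  proof (cases "x = 0")
    case False
    have "N u \<le> N ((1 / norm x) *\<^sub>R x)" using False by (intro u(2)) simp
    also have "\<dots> = N x / norm x" by (simp add: is_norm_scaleR[OF assms])
    finally show ?thesis using False pos by (simp add: field_simps)
  qed (simp add: is_norm_zero[OF assms])
  with pos show ?thesis by (intro that[of "1 / N u"]) auto
qed

lemma bdd_above_dual_norm:
  fixes N :: "real ^ 'n \<Rightarrow> real"
  assumes "is_norm N"
  shows "bdd_above ((\<lambda>u. \<bar>z \<bullet> u\<bar>) ` {u. N u \<le> 1})"
proof -
  obtain c where c: "c > 0" "\<And>x. norm x \<le> c * N x" using norm_le_is_norm[OF assms] by metis
  have "\<bar>z \<bullet> u\<bar> \<le> norm z * c" if "N u \<le> 1" for u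
  proof -
    have "norm u \<le> c" using c(2)[of u] mult_left_mono[OF that, of c] c(1) by linarith
    then show ?thesis
      using Cauchy_Schwarz_ineq2[of z u] mult_left_mono[of "norm u" c "norm z"] by simp
  qed
  then show ?thesis by (intro bdd_aboveI2) auto
qed

lemma abs_inner_le_dual_norm:
  fixes N :: "real ^ 'n \<Rightarrow> real"
  assumes "is_norm N"
  shows "\<bar>z \<bullet> u\<bar> \<le> dual_norm N z * N u"
proof (cases "u = 0")
  case False
  then have pos: "N u > 0"
    using is_norm_nonneg[OF assms, of u] is_norm_eq_0_iff[OF assms, of u] by linarith
  have "\<bar>z \<bullet> ((1 / N u) *\<^sub>R u)\<bar> \<le> dual_norm N z"
    unfolding dual_norm_def
    by (rule cSUP_upper[OF _ bdd_above_dual_norm[OF assms]])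
      (use pos in \<open>simp add: is_norm_scaleR[OF assms]\<close>)
  then show ?thesis using pos by (simp add: abs_mult field_simps)
qed (simp add: is_norm_zero[OF assms])

lemma dual_norm_least:
  assumes "is_norm N" "\<And>u. N u \<le> 1 \<Longrightarrow> \<bar>z \<bullet> u\<bar> \<le> c"
  shows "dual_norm N z \<le> c"
  unfolding dual_norm_def
proof (rule cSUP_least)
  have "0 \<in> {u. N u \<le> 1}" by (simp add: is_norm_zero[OF assms(1)])
  then show "{u. N u \<le> 1} \<noteq> {}" by blast
qed (use assms(2) in auto)

lemma abs_inner_le_dual_norm_unit:
  assumes "is_norm N" "N u \<le> 1"
  shows "\<bar>z \<bullet> u\<bar> \<le> dual_norm N z"
  unfolding dual_norm_def using assms by (intro cSUP_upper bdd_above_dual_norm) auto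

lemma is_norm_dual_norm:
  assumes "is_norm N"
  shows "is_norm (dual_norm N)"
proof -
  let ?D = "dual_norm N"
  note ub = abs_inner_le_dual_norm_unit[OF assms]
  have nn: "0 \<le> ?D z" for z
    using ub[of 0 z] by (simp add: is_norm_zero[OF assms])
  have zero: "?D 0 = 0"
    by (intro antisym nn dual_norm_least[OF assms]) auto
  have zeroD: "z = 0" if "?D z = 0" for z
    using abs_inner_le_dual_norm[OF assms, of z z] that
    by (metis abs_le_zero_iff inner_eq_zero_iff mult_zero_left)
  have scale_le: "?D (c *\<^sub>R z) \<le> \<bar>c\<bar> * ?D z" for c z
    by (rule dual_norm_least[OF assms]) (simp add: abs_mult mult_left_mono ub)
  have scale: "?D (c *\<^sub>R z) = \<bar>c\<bar> * ?D z" for c z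
  proof (cases "c = 0")
    case False
    have "\<bar>c\<bar> * ?D z \<le> ?D (c *\<^sub>R z)"
      using scale_le[of "1 / c" "c *\<^sub>R z"] False by (simp add: field_simps)
    with scale_le[of c z] show ?thesis by simp
  qed (simp add: zero)
  have tri: "?D (y + z) \<le> ?D y + ?D z" for y z
  proof (rule dual_norm_least[OF assms])
    fix u assume u: "N u \<le> 1"
    show "\<bar>(y + z) \<bullet> u\<bar> \<le> ?D y + ?D z"
      using ub[OF u, of y] ub[OF u, of z] by (simp add: inner_add_left)
  qed
  show ?thesis unfolding is_norm_def using nn zero zeroD scale tri by blast
qed

section \<open>Subgradients of convex functions\<close>

lemma supporting_hyperplane_not_interior:
  fixes S :: "'a::euclidean_space set"
  assumes "convex S" "x \<in> S" "x \<notin> interior S"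
  obtains a where "a \<noteq> 0" "\<And>z. z \<in> S \<Longrightarrow> a \<bullet> z \<le> a \<bullet> x"
proof (cases "interior S = {}")
  case True
  then obtain a c where "a \<noteq> 0" "S \<subseteq> {x. a \<bullet> x = c}"
    using empty_interior_subset_hyperplane[OF assms(1)] by metis
  then have "a \<bullet> z \<le> a \<bullet> x" if "z \<in> S" for z
    using assms(2) that by (metis (mono_tags) mem_Collect_eq order_refl subsetD)
  then show ?thesis using \<open>a \<noteq> 0\<close> by (intro that[of a])
next
  case False
  obtain a c where a: "a \<noteq> 0" "\<forall>z\<in>interior S. a \<bullet> z \<le> c" "\<forall>z\<in>{x}. a \<bullet> z \<ge> c"
    using separating_hyperplane_sets[of "interior S" "{x}"] False assms
    by (auto simp: convex_interior)
  have "closure (interior S) \<subseteq> {z. a \<bullet> z \<le> c}"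
    using a(2) by (intro closure_minimal closed_halfspace_le) auto
  then have "S \<subseteq> {z. a \<bullet> z \<le> c}"
    using convex_closure_interior[OF assms(1) False] closure_subset by blast
  then show ?thesis using a by (intro that[of a]) force+
qed

text \<open>
  At a point of the domain \<open>S\<close> outside its interior the subdifferential absorbs the normal cone of
  \<open>S\<close>, which is nontrivial there.  So it can only be bounded and nonempty at interior points.
\<close>

lemma bounded_subdifferential_imp_interior:
  assumes N: "is_norm N" and "convex S" "x \<in> S" and g: "g \<in> subdifferential S h x"
    and bound: "\<And>g. g \<in> subdifferential S h x \<Longrightarrow> dual_norm N g \<le> G"
  shows "x \<in> interior S"
proof (rule ccontr)
  assume "x \<notin> interior S"
  then obtain a where a: "a \<noteq> 0" "\<And>z. z \<in> S \<Longrightarrow> a \<bullet> z \<le> a \<bullet> x"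
    using supporting_hyperplane_not_interior assms(2,3) by metis
  \<comment> \<open>Large enough for \<open>g + s *\<^sub>R a\<close> to pair with \<open>a\<close> to more than \<open>G * N a\<close>.\<close>
  define s where "s = (G * N a + \<bar>g \<bullet> a\<bar> + 1) / (a \<bullet> a)"
  have "dual_norm N g \<ge> 0" by (rule is_norm_nonneg[OF is_norm_dual_norm[OF N]])
  then have "G \<ge> 0" using bound[OF g] by linarith
  have s: "s \<ge> 0" unfolding s_def using \<open>G \<ge> 0\<close> is_norm_nonneg[OF N, of a] by auto
  have "g + s *\<^sub>R a \<in> subdifferential S h x"
    unfolding subdifferential_def
  proof (intro CollectI ballI)
    fix z assume z: "z \<in> S"
    have "s * (a \<bullet> (z - x)) \<le> 0"
      using a(2)[OF z] s by (simp add: mult_le_0_iff inner_diff_right)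
    moreover have "h x + g \<bullet> (z - x) \<le> h z" using g z unfolding subdifferential_def by blast
    ultimately show "h x + (g + s *\<^sub>R a) \<bullet> (z - x) \<le> h z" by (simp add: inner_add_left)
  qed
  from bound[OF this] have "dual_norm N (g + s *\<^sub>R a) * N a \<le> G * N a"
    by (rule mult_right_mono) (rule is_norm_nonneg[OF N])
  then have "(g + s *\<^sub>R a) \<bullet> a \<le> G * N a"
    using abs_inner_le_dual_norm[OF N, of "g + s *\<^sub>R a" a] by linarith
  moreover have "s * (a \<bullet> a) = G * N a + \<bar>g \<bullet> a\<bar> + 1" using a(1) by (simp add: s_def)
  ultimately show False by (simp add: inner_add_left)
qed

text \<open>
  A supporting hyperplane of the epigraph at \<open>(x, h x)\<close> cannot be vertical when \<open>x\<close> is interior, so it is the graph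
  of an affine minorant.
\<close>

lemma subgradient_exists_interior:
  fixes h :: "real ^ 'n \<Rightarrow> real"
  assumes cv: "convex_on S h" and x: "x \<in> interior S"
  shows "subdifferential S h x \<noteq> {}"
proof -
  have S: "convex S" using cv by (rule convex_on_imp_convex)
  have xS: "x \<in> S" using x interior_subset by blast
  let ?E = "epigraph S h"
  have E: "convex ?E" using cv by (simp add: convex_epigraph S)
  have "(x, h x) \<notin> interior ?E"
  proof
    assume "(x, h x) \<in> interior ?E"
    then obtain e where e: "e > 0" "ball (x, h x) e \<subseteq> ?E" by (meson mem_interior)
    have "(x, h x - e / 2) \<in> ball (x, h x) e" using e(1) by (simp add: dist_Pair_Pair dist_real_def)
    with e show False by (auto simp: epigraph_def)
  qed
  moreover have "(x, h x) \<in> ?E" using xS by (simp add: epigraph_def)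
  ultimately obtain p where p: "p \<noteq> 0" "\<And>z. z \<in> ?E \<Longrightarrow> p \<bullet> z \<le> p \<bullet> (x, h x)"
    using supporting_hyperplane_not_interior E by metis
  obtain a c where pac: "p = (a, c)" by (cases p)
  have ac: "a \<bullet> z + c * r \<le> a \<bullet> x + c * h x" if "z \<in> S" "h z \<le> r" for z r
    using p(2)[of "(z, r)"] that by (simp add: epigraph_def pac)
  have "c \<le> 0" using ac[OF xS, of "h x + 1"] by (simp add: algebra_simps)
  have "c \<noteq> 0"
  proof
    assume [simp]: "c = 0"
    then have a: "a \<noteq> 0" using p(1) pac by (simp add: zero_prod_def)
    obtain e where e: "e > 0" "ball x e \<subseteq> S" using x by (meson mem_interior)
    have "x + (e / (2 * norm a)) *\<^sub>R a \<in> S"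
      using e a by (intro subsetD[OF e(2)]) (simp add: dist_norm)
    from ac[OF this order_refl] have "e / (2 * norm a) * (a \<bullet> a) \<le> 0"
      by (simp add: inner_add_right)
    moreover have "0 < e / (2 * norm a) * (a \<bullet> a)" using e(1) a by (intro mult_pos_pos) auto
    ultimately show False by linarith
  qed
  with \<open>c \<le> 0\<close> have c: "c < 0" by simp
  have "(-1 / c) *\<^sub>R a \<in> subdifferential S h x"
    unfolding subdifferential_def
  proof (intro CollectI ballI)
    fix z assume "z \<in> S"
    from ac[OF this order_refl] have "a \<bullet> (z - x) \<le> - c * (h z - h x)"
      by (simp add: inner_diff_right algebra_simps)
    then show "h x + ((-1 / c) *\<^sub>R a) \<bullet> (z - x) \<le> h z"
      using c by (simp add: field_simps)
  qed
  then show ?thesis by blast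
qed

section \<open>Consensus over time-varying networks\<close>

lemma
  assumes "network_assumption W B \<eta>"
  shows network_doubly_stochastic: "t \<ge> 1 \<Longrightarrow> doubly_stochastic (W t)"
    and network_period: "B \<ge> 1"
    and network_strongly_connected: "(i, j) \<in> (\<Union>t\<in>{k * B + 1..(k + 1) * B}. comm_edges (W t))\<^sup>*"
    and network_weight_pos: "0 < \<eta>"
    and network_weight_less_1: "\<eta> < 1"
    and network_self_loop: "t \<ge> 1 \<Longrightarrow> \<eta> \<le> W t $ i $ i"
    and network_edge: "t \<ge> 1 \<Longrightarrow> (j, i) \<in> comm_edges (W t) \<Longrightarrow> \<eta> \<le> W t $ i $ j"
  using assms unfolding network_assumption_def by blast+

text \<open>
  The product \<open>W (s + r - 1) ** \<dots> ** W s\<close>, which maps the agents' states at time \<open>s\<close> to the states at time \<open>s + r\<close>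
  when nothing but mixing takes place.
\<close>

primrec transition :: "(nat \<Rightarrow> real ^ 'm ^ 'm) \<Rightarrow> nat \<Rightarrow> nat \<Rightarrow> real ^ 'm ^ 'm" where
  "transition W s 0 = mat 1"
| "transition W s (Suc r) = W (s + r) ** transition W s r"

lemma transition_Suc_entry:
  "transition W s (Suc r) $ i $ j = (\<Sum>k\<in>UNIV. W (s + r) $ i $ k * transition W s r $ k $ j)"
  by (simp add: matrix_matrix_mult_def)

lemma transition_nonneg:
  assumes "\<And>t. t \<ge> s \<Longrightarrow> doubly_stochastic (W t)"
  shows "0 \<le> transition W s r $ i $ j"
proof (induction r arbitrary: i)
  case 0
  then show ?case by (simp add: mat_def)
next
  case (Suc r)
  have "0 \<le> W (s + r) $ i $ k" for k using assms[of "s + r"] by (simp add: doubly_stochastic_def)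
  with Suc show ?case unfolding transition_Suc_entry by (intro sum_nonneg mult_nonneg_nonneg)
qed

lemma transition_row_sum:
  assumes "\<And>t. t \<ge> s \<Longrightarrow> doubly_stochastic (W t)"
  shows "(\<Sum>j\<in>UNIV. transition W s r $ i $ j) = 1"
proof (induction r arbitrary: i)
  case 0
  then show ?case by (simp add: mat_def)
next
  case (Suc r)
  have "(\<Sum>j\<in>UNIV. transition W s (Suc r) $ i $ j)
      = (\<Sum>k\<in>UNIV. W (s + r) $ i $ k * (\<Sum>j\<in>UNIV. transition W s r $ k $ j))"
    by (simp only: transition_Suc_entry sum_distrib_left) (rule sum.swap)
  also have "\<dots> = 1" using assms[of "s + r"] by (simp add: Suc doubly_stochastic_def)
  finally show ?case .
qed

text \<open>
  Follow the set of agents that carry weight at least \<open>\<eta> ^ r\<close> from a fixed source after \<open>r\<close> steps.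
  Self-loops keep agents in this set.  If the set were the same before and after a block
  of \<open>B\<close> steps, no edge of that block would leave it, and by strong connectivity it would contain
  everybody.  So it gains an agent in every block, and a window that contains \<open>CARD('m)\<close> complete blocks
  fills the whole column of the source.
\<close>

lemma transition_entries_bounded_below:
  fixes W :: "nat \<Rightarrow> real ^ 'm ^ 'm"
  assumes net: "network_assumption W B \<eta>" and s: "s \<ge> 1"
  shows "\<eta> ^ ((CARD('m) + 1) * B) \<le> transition W s ((CARD('m) + 1) * B) $ i $ j"
proof -
  have ds: "doubly_stochastic (W t)" if "t \<ge> s" for t
    using network_doubly_stochastic[OF net] s that by simp
  note B = network_period[OF net]
  note eta = network_weight_pos[OF net] network_weight_less_1[OF net]
  define R where "R r = {i. \<eta> ^ r \<le> transition W s r $ i $ j}" for r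
  have step: "i \<in> R (Suc r)" if "k \<in> R r" "\<eta> \<le> W (s + r) $ i $ k" for i k r
  proof -
    have nn: "0 \<le> W (s + r) $ i $ k" for k using ds[of "s + r"] by (simp add: doubly_stochastic_def)
    have "\<eta> ^ Suc r \<le> W (s + r) $ i $ k * transition W s r $ k $ j"
      using that eta by (auto simp: R_def intro!: mult_mono)
    also have "\<dots> \<le> transition W s (Suc r) $ i $ j"
      unfolding transition_Suc_entry
      by (rule member_le_sum) (auto intro!: mult_nonneg_nonneg nn transition_nonneg ds)
    finally show ?thesis by (simp add: R_def)
  qed
  have mono1: "R r \<subseteq> R (Suc r)" for r
    using network_self_loop[OF net, of "s + r"] s by (auto intro: step)
  have mono: "R r \<subseteq> R r'" if "r \<le> r'" for r r'
    using lift_Suc_mono_le[of R, OF mono1 that] .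
  have j0: "j \<in> R 0" by (simp add: R_def mat_def)
  have grow: "R r = UNIV \<or> R r \<subset> R (r + B)" if r: "s + r = k * B + 1" for r k
  proof (rule ccontr)
    assume "\<not> ?thesis"
    with mono[of r "r + B"] have eq: "R (r + B) = R r" and ne: "R r \<noteq> UNIV" by auto
    have same: "R r' = R r" if "r \<le> r'" "r' \<le> r + B" for r'
      using mono[OF that(1)] mono[OF that(2)] eq by blast
    have closed: "i \<in> R r" if "(l, i) \<in> (\<Union>t\<in>{k * B + 1..(k + 1) * B}. comm_edges (W t))" "l \<in> R r" for l i
    proof -
      obtain t where t: "t \<in> {k * B + 1..(k + 1) * B}" "(l, i) \<in> comm_edges (W t)"
        using \<open>(l, i) \<in> _\<close> by blast
      define r' where "r' = t - s"
      have r': "t = s + r'" "r \<le> r'" "Suc r' \<le> r + B" using t(1) r by (auto simp: r'_def)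
      have "\<eta> \<le> W (s + r') $ i $ l"
        using network_edge[OF net _ t(2)] s r'(1) by simp
      moreover have "l \<in> R r'" using that(2) same[of r'] r' by auto
      ultimately have "i \<in> R (Suc r')" by (intro step)
      then show ?thesis using same[of "Suc r'"] r' by auto
    qed
    have "j \<in> R r" using j0 mono[of 0 r] by auto
    have "i \<in> R r" for i
    proof -
      have "(j, i) \<in> (\<Union>t\<in>{k * B + 1..(k + 1) * B}. comm_edges (W t))\<^sup>*"
        by (rule network_strongly_connected[OF net])
      then show ?thesis
        by (induction rule: rtrancl_induct) (use \<open>j \<in> R r\<close> closed in auto)
    qed
    with ne show False by auto
  qed
  \<comment> \<open>The first block that starts at or after time \<open>s\<close> starts at \<open>k0 * B + 1\<close>, fewer than \<open>B\<close> steps later.\<close>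
  define k0 where "k0 = (s + B - 2) div B"
  have "s \<le> k0 * B + 1" "k0 * B + 1 < s + B"
  proof -
    have "k0 * B + (s + B - 2) mod B = s + B - 2" unfolding k0_def by simp
    moreover have "(s + B - 2) mod B < B" using B by simp
    ultimately show "s \<le> k0 * B + 1" "k0 * B + 1 < s + B" using s B by linarith+
  qed
  then obtain r0 where r0: "s + r0 = k0 * B + 1" "r0 < B"
    by (metis add_less_cancel_left le_Suc_ex)
  have count: "R (r0 + p * B) = UNIV \<or> p + 1 \<le> card (R (r0 + p * B))" for p
  proof (induction p)
    case 0
    have "j \<in> R r0" using j0 mono[of 0 r0] by auto
    then have "R r0 \<noteq> {}" by blast
    then show ?case by (simp add: Suc_le_eq card_gt_0_iff)
  next
    case (Suc p)
    have "s + (r0 + p * B) = (k0 + p) * B + 1" using r0(1) by (simp add: algebra_simps)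
    from grow[OF this] have gr: "R (r0 + p * B) = UNIV \<or> R (r0 + p * B) \<subset> R (r0 + Suc p * B)"
      by (simp add: algebra_simps)
    have sub: "R (r0 + p * B) \<subseteq> R (r0 + Suc p * B)" by (rule mono) simp
    show ?case
    proof (cases "R (r0 + p * B) = UNIV")
      case True
      with sub show ?thesis by blast
    next
      case False
      with gr have "card (R (r0 + p * B)) < card (R (r0 + Suc p * B))"
        by (intro psubset_card_mono) simp_all
      with False Suc show ?thesis by linarith
    qed
  qed
  have "R (r0 + CARD('m) * B) = UNIV"
  proof -
    have "card (R (r0 + CARD('m) * B)) \<le> CARD('m)" by (rule card_mono) simp_all
    then show ?thesis using count[of "CARD('m)"] by linarith
  qed
  moreover have "r0 + CARD('m) * B \<le> (CARD('m) + 1) * B" using r0(2) by simp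
  ultimately have "R ((CARD('m) + 1) * B) = UNIV" using mono by blast
  then show ?thesis unfolding R_def by blast
qed

definition spread :: "(real ^ 'n \<Rightarrow> real) \<Rightarrow> ('m::finite \<Rightarrow> real ^ 'n) \<Rightarrow> real" where
  "spread N z = Max (range (\<lambda>(i, j). N (z i - z j)))"

lemma le_spread: "N (z i - z j) \<le> spread N z"
proof -
  have "(\<lambda>(i, j). N (z i - z j)) (i, j) \<in> range (\<lambda>(i, j). N (z i - z j))" by (rule rangeI)
  then show ?thesis unfolding spread_def by (intro Max_ge) simp_all
qed

lemma spread_le: "(\<And>i j. N (z i - z j) \<le> c) \<Longrightarrow> spread N z \<le> c"
  unfolding spread_def by (subst Max_le_iff) auto

lemma spread_nonneg: "is_norm N \<Longrightarrow> 0 \<le> spread N z"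
  by (rule order_trans[OF is_norm_nonneg le_spread])

lemma is_norm_convex_combination_diff_le:
  fixes z :: "'m::finite \<Rightarrow> real ^ 'n"
  assumes N: "is_norm N" and a: "\<And>j. 0 \<le> a j" "(\<Sum>j\<in>UNIV. a j) = 1"
  shows "N ((\<Sum>j\<in>UNIV. a j *\<^sub>R z j) - z i) \<le> spread N z"
proof -
  have "(\<Sum>j\<in>UNIV. a j *\<^sub>R z j) - z i = (\<Sum>j\<in>UNIV. a j *\<^sub>R (z j - z i))"
    by (simp add: scaleR_diff_right sum_subtractf a(2) flip: scaleR_left.sum)
  then have "N ((\<Sum>j\<in>UNIV. a j *\<^sub>R z j) - z i) \<le> (\<Sum>j\<in>UNIV. N (a j *\<^sub>R (z j - z i)))"
    using is_norm_sum_le[OF N, of UNIV "\<lambda>j. a j *\<^sub>R (z j - z i)"] by simp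
  also have "\<dots> \<le> (\<Sum>j\<in>UNIV. a j * spread N z)"
    by (intro sum_mono) (simp add: is_norm_scaleR[OF N] a mult_left_mono le_spread)
  also have "\<dots> = spread N z" by (simp add: a(2) flip: sum_distrib_right)
  finally show ?thesis .
qed

text \<open>
  In the difference of two convex combinations of the same points, the diagonal pairs cancel; they
  carry at least the mass \<open>\<rho>\<close> if one of the combinations has weights at least \<open>\<rho>\<close>.
\<close>

lemma spread_contraction:
  fixes z :: "'m::finite \<Rightarrow> real ^ 'n"
  assumes N: "is_norm N"
    and P: "\<And>i j. \<rho> \<le> P i j" "0 \<le> \<rho>" "\<And>i. (\<Sum>j\<in>UNIV. P i j) = 1"
  shows "spread N (\<lambda>i. \<Sum>j\<in>UNIV. P i j *\<^sub>R z j) \<le> (1 - \<rho>) * spread N z"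
proof (rule spread_le)
  fix i i'
  have Pn: "0 \<le> P i j" for i j using P(1)[of i j] P(2) by linarith
  have "(\<Sum>j\<in>UNIV. P i j *\<^sub>R z j) = (\<Sum>j\<in>UNIV. \<Sum>k\<in>UNIV. (P i j * P i' k) *\<^sub>R z j)"
    by (simp add: P(3) flip: sum_distrib_left scaleR_left.sum)
  moreover have "(\<Sum>k\<in>UNIV. P i' k *\<^sub>R z k) = (\<Sum>j\<in>UNIV. \<Sum>k\<in>UNIV. (P i j * P i' k) *\<^sub>R z k)"
    by (subst sum.swap) (simp add: P(3) flip: sum_distrib_right scaleR_left.sum)
  ultimately have "N ((\<Sum>j\<in>UNIV. P i j *\<^sub>R z j) - (\<Sum>k\<in>UNIV. P i' k *\<^sub>R z k))
      = N (\<Sum>j\<in>UNIV. \<Sum>k\<in>UNIV. (P i j * P i' k) *\<^sub>R (z j - z k))"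
    by (simp add: scaleR_diff_right sum_subtractf)
  also have "\<dots> \<le> (\<Sum>j\<in>UNIV. N (\<Sum>k\<in>UNIV. (P i j * P i' k) *\<^sub>R (z j - z k)))"
    by (rule is_norm_sum_le[OF N]) simp
  also have "\<dots> \<le> (\<Sum>j\<in>UNIV. \<Sum>k\<in>UNIV. N ((P i j * P i' k) *\<^sub>R (z j - z k)))"
    by (intro sum_mono is_norm_sum_le[OF N]) simp
  also have "\<dots> \<le> (\<Sum>j\<in>UNIV. \<Sum>k\<in>UNIV. P i j * P i' k * spread N z - (if k = j then P i j * P i' j * spread N z else 0))"
    by (intro sum_mono)
      (simp add: is_norm_scaleR[OF N] is_norm_zero[OF N] Pn mult_left_mono le_spread)
  also have "\<dots> = spread N z * (1 - (\<Sum>j\<in>UNIV. P i j * P i' j))"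
  proof -
    have row: "(\<Sum>k\<in>UNIV. P i j * P i' k * spread N z - (if k = j then P i j * P i' j * spread N z else 0))
        = P i j * spread N z - P i j * P i' j * spread N z" for j
      by (simp add: sum_subtractf P(3) flip: sum_distrib_left sum_distrib_right)
    show ?thesis
      unfolding row
      by (simp add: sum_subtractf P(3) right_diff_distrib mult.commute[of "spread N z"] flip: sum_distrib_right)
  qed
  also have "\<dots> \<le> spread N z * (1 - \<rho>)"
  proof (rule mult_left_mono[OF _ spread_nonneg[OF N]])
    have "\<rho> = (\<Sum>j\<in>UNIV. P i j * \<rho>)" by (simp add: P(3) flip: sum_distrib_right)
    also have "\<dots> \<le> (\<Sum>j\<in>UNIV. P i j * P i' j)" by (intro sum_mono mult_left_mono P Pn)
    finally show "1 - (\<Sum>j\<in>UNIV. P i j * P i' j) \<le> 1 - \<rho>" by simp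
  qed
  finally show "N ((\<Sum>j\<in>UNIV. P i j *\<^sub>R z j) - (\<Sum>k\<in>UNIV. P i' k *\<^sub>R z k)) \<le> (1 - \<rho>) * spread N z"
    by (simp add: mult.commute)
qed

lemma spread_perturb:
  assumes N: "is_norm N" and "\<And>i. N (z i - z' i) \<le> d"
  shows "spread N z \<le> spread N z' + 2 * d"
proof (rule spread_le)
  fix i j
  have "N (z i - z j) \<le> N (z i - z' i) + N (z' i - z' j) + N (z' j - z j)"
    using is_norm_triangle_via[OF N, of "z i" "z j" "z' i"]
      is_norm_triangle_via[OF N, of "z' i" "z j" "z' j"] by linarith
  also have "\<dots> \<le> d + spread N z' + d"
    using assms(2)[of i] assms(2)[of j] le_spread[of N z' i j]
      is_norm_minus_commute[OF N, of "z j" "z' j"] by linarith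
  finally show "N (z i - z j) \<le> spread N z' + 2 * d" by simp
qed

text \<open>
  Averaging does not expand the norm, so perturbations only add up over time.
\<close>

lemma perturbed_averaging_deviation:
  fixes z :: "nat \<Rightarrow> 'm::finite \<Rightarrow> real ^ 'n"
  assumes N: "is_norm N" and ds: "\<And>t. t \<ge> s \<Longrightarrow> doubly_stochastic (W t)"
    and pert: "\<And>t i. t \<ge> s \<Longrightarrow> N (z (Suc t) i - (\<Sum>j\<in>UNIV. W t $ i $ j *\<^sub>R z t j)) \<le> e t"
  shows "N (z (s + r) i - (\<Sum>j\<in>UNIV. transition W s r $ i $ j *\<^sub>R z s j)) \<le> (\<Sum>q<r. e (s + q))"
proof (induction r arbitrary: i)
  case 0
  have "(\<Sum>j\<in>UNIV. (mat 1 :: real ^ 'm ^ 'm) $ i $ j *\<^sub>R z s j) = (\<Sum>j\<in>UNIV. if j = i then z s j else 0)"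
    by (intro sum.cong) (auto simp: mat_def)
  then show ?case by (simp add: is_norm_zero[OF N])
next
  case (Suc r)
  let ?P = "transition W s r" and ?w = "\<lambda>k. W (s + r) $ i $ k"
  have w: "0 \<le> ?w k" "(\<Sum>k\<in>UNIV. ?w k) = 1" for k
    using ds[of "s + r"] by (auto simp: doubly_stochastic_def)
  have "(\<Sum>j\<in>UNIV. transition W s (Suc r) $ i $ j *\<^sub>R z s j)
      = (\<Sum>k\<in>UNIV. ?w k *\<^sub>R (\<Sum>j\<in>UNIV. ?P $ k $ j *\<^sub>R z s j))"
    unfolding transition_Suc_entry scaleR_left.sum scaleR_right.sum
    by (subst sum.swap) simp
  then have "(\<Sum>k\<in>UNIV. ?w k *\<^sub>R z (s + r) k) - (\<Sum>j\<in>UNIV. transition W s (Suc r) $ i $ j *\<^sub>R z s j)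
      = (\<Sum>k\<in>UNIV. ?w k *\<^sub>R (z (s + r) k - (\<Sum>j\<in>UNIV. ?P $ k $ j *\<^sub>R z s j)))"
    by (simp add: scaleR_diff_right sum_subtractf)
  then have "N ((\<Sum>k\<in>UNIV. ?w k *\<^sub>R z (s + r) k) - (\<Sum>j\<in>UNIV. transition W s (Suc r) $ i $ j *\<^sub>R z s j))
      \<le> (\<Sum>k\<in>UNIV. N (?w k *\<^sub>R (z (s + r) k - (\<Sum>j\<in>UNIV. ?P $ k $ j *\<^sub>R z s j))))"
    by (simp add: is_norm_sum_le[OF N])
  also have "\<dots> \<le> (\<Sum>k\<in>UNIV. ?w k * (\<Sum>q<r. e (s + q)))"
    by (intro sum_mono) (simp add: is_norm_scaleR[OF N] w mult_left_mono Suc)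
  also have "\<dots> = (\<Sum>q<r. e (s + q))" by (simp add: w(2) flip: sum_distrib_right)
  finally show ?case
    using pert[of "s + r" i] is_norm_triangle_via[OF N, of "z (s + Suc r) i"
        "\<Sum>j\<in>UNIV. transition W s (Suc r) $ i $ j *\<^sub>R z s j" "\<Sum>k\<in>UNIV. ?w k *\<^sub>R z (s + r) k"]
    by simp
qed

text \<open>
  Each \<open>V (t + n)\<close> in the sum is at most \<open>(1 - \<rho>) * V t\<close> up to perturbations, so the sum is at most
  \<open>1 - \<rho>\<close> times itself plus the first \<open>n\<close> terms and \<open>2 * n\<close> times all perturbations.
\<close>

lemma sum_le_of_delayed_contraction:
  fixes V e :: "nat \<Rightarrow> real"
  assumes n: "n \<ge> 1" and rho: "0 < \<rho>" "\<rho> \<le> 1"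
    and e: "\<And>t. 0 \<le> e t" and V: "\<And>t. 0 \<le> V t"
    and step: "\<And>t. V (Suc t) \<le> V t + 2 * e t"
    and contr: "\<And>t. V (t + n) \<le> (1 - \<rho>) * V t + 2 * (\<Sum>q<n. e (t + q))"
  shows "(\<Sum>t<T. V t) \<le> real n / \<rho> * (V 0 + 4 * (\<Sum>t<T. e t))"
proof -
  let ?E = "\<Sum>t<T. e t"
  have V_le: "V t \<le> V 0 + 2 * ?E" if "t < T" for t
  proof -
    have "V t \<le> V 0 + 2 * (\<Sum>q<t. e q)"
    proof (induction t)
      case (Suc t)
      then show ?case using step[of t] by simp
    qed simp
    also have "(\<Sum>q<t. e q) \<le> ?E" using that e by (intro sum_mono2) auto
    finally show ?thesis by simp
  qed
  have E: "?E \<ge> 0" by (intro sum_nonneg e)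
  have start: "(\<Sum>t<T'. V t) \<le> n * (V 0 + 2 * ?E)" if "T' \<le> n" "T' \<le> T" for T'
  proof -
    have "(\<Sum>t<T'. V t) \<le> (\<Sum>t<T'. V 0 + 2 * ?E)" using that by (intro sum_mono V_le) auto
    also have "\<dots> \<le> n * (V 0 + 2 * ?E)" using that V[of 0] E by (simp add: mult_right_mono)
    finally show ?thesis .
  qed
  have "\<rho> * (\<Sum>t<T. V t) \<le> n * (V 0 + 4 * ?E)"
  proof (cases "T \<le> n")
    case True
    have "\<rho> * (\<Sum>t<T. V t) \<le> 1 * (\<Sum>t<T. V t)"
      using rho by (intro mult_right_mono sum_nonneg V)
    also have "\<dots> \<le> n * (V 0 + 2 * ?E)" using start[of T] True by simp
    also have "\<dots> \<le> n * (V 0 + 4 * ?E)" using E by (intro mult_left_mono) auto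
    finally show ?thesis .
  next
    case False
    then obtain T' where T': "T = T' + n" by (metis le_add_diff_inverse2 nat_le_linear)
    have "(\<Sum>t<T. V t) = (\<Sum>t<n. V t) + (\<Sum>t<T'. V (t + n))"
      unfolding T' by (induction T') (simp_all add: add_ac)
    also have "(\<Sum>t<T'. V (t + n)) \<le> (\<Sum>t<T'. (1 - \<rho>) * V t + 2 * (\<Sum>q<n. e (t + q)))"
      by (intro sum_mono contr)
    also have "\<dots> = (1 - \<rho>) * (\<Sum>t<T'. V t) + 2 * (\<Sum>q<n. \<Sum>t<T'. e (t + q))"
      by (simp add: sum.distrib sum.swap[of _ "{..<n}"] flip: sum_distrib_left)
    also have "(\<Sum>q<n. \<Sum>t<T'. e (t + q)) \<le> (\<Sum>q<n. ?E)"
    proof (rule sum_mono)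
      fix q assume "q \<in> {..<n}"
      have "(\<Sum>t<T'. e (t + q)) = sum e ((\<lambda>t. t + q) ` {..<T'})" by (subst sum.reindex) auto
      also have "\<dots> \<le> ?E" using e \<open>q \<in> _\<close> T' by (intro sum_mono2) auto
      finally show "(\<Sum>t<T'. e (t + q)) \<le> ?E" .
    qed
    also have "(1 - \<rho>) * (\<Sum>t<T'. V t) \<le> (1 - \<rho>) * (\<Sum>t<T. V t)"
      using rho V T' by (intro mult_left_mono sum_mono2) auto
    finally have "(\<Sum>t<T. V t) \<le> (\<Sum>t<n. V t) + ((1 - \<rho>) * (\<Sum>t<T. V t) + 2 * (n * ?E))" by simp
    then show ?thesis using start[of n] False by (simp add: algebra_simps)
  qed
  then show ?thesis using rho by (simp add: field_simps)
qed

text \<open>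
  Every window of \<open>(CARD('m) + 1) * B\<close> steps contracts the spread by a fixed factor, so each perturbation is
  forgotten geometrically fast and contributes a bounded amount to the sum of all spreads.
\<close>

lemma consensus_spread_sum:
  fixes W :: "nat \<Rightarrow> real ^ 'm ^ 'm"
  assumes net: "network_assumption W B \<eta>" and N: "is_norm N"
  shows "\<exists>c>0. \<forall>(z :: nat \<Rightarrow> 'm \<Rightarrow> real ^ 'n) e T.
       (\<forall>t\<ge>1. \<forall>i. N (z (Suc t) i - (\<Sum>j\<in>UNIV. W t $ i $ j *\<^sub>R z t j)) \<le> e t) \<longrightarrow>
       (\<Sum>t=1..T. spread N (z t)) \<le> c * (spread N (z 1) + (\<Sum>t=1..T. e t))"
proof -
  define n where "n = (CARD('m) + 1) * B"
  define \<rho> where "\<rho> = \<eta> ^ n"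
  have ds: "doubly_stochastic (W t)" if "t \<ge> 1" for t
    using network_doubly_stochastic[OF net that] .
  have n: "n \<ge> 1" and rho: "0 < \<rho>" "\<rho> \<le> 1"
    using network_period[OF net] network_weight_pos[OF net] network_weight_less_1[OF net]
    by (auto simp: n_def \<rho>_def power_le_one)
  have main: "(\<Sum>t=1..T. spread N (z t)) \<le> 4 * real n / \<rho> * (spread N (z 1) + (\<Sum>t=1..T. e t))"
    if pert: "\<And>t i. t \<ge> 1 \<Longrightarrow> N (z (Suc t) i - (\<Sum>j\<in>UNIV. W t $ i $ j *\<^sub>R z t j)) \<le> e t"
    for z :: "nat \<Rightarrow> 'm \<Rightarrow> real ^ 'n" and e T
  proof -
    have e: "0 \<le> e t" if "t \<ge> 1" for t
      using pert[OF that] is_norm_nonneg[OF N] order_trans by blast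
    have window: "spread N (z (Suc t + r)) \<le>
        spread N (\<lambda>i. \<Sum>j\<in>UNIV. transition W (Suc t) r $ i $ j *\<^sub>R z (Suc t) j) + 2 * (\<Sum>q<r. e (Suc t + q))" for t r
      by (intro spread_perturb[OF N] perturbed_averaging_deviation[OF N]) (auto intro!: ds pert)
    have "spread N (z (Suc (Suc t))) \<le> spread N (z (Suc t)) + 2 * e (Suc t)" for t
    proof -
      have "spread N (\<lambda>i. \<Sum>j\<in>UNIV. transition W (Suc t) 1 $ i $ j *\<^sub>R z (Suc t) j) \<le> (1 - 0) * spread N (z (Suc t))"
        by (rule spread_contraction[OF N]) (auto simp del: transition.simps intro!: transition_nonneg transition_row_sum ds)
      then show ?thesis using window[of t 1] by (simp del: transition.simps)
    qed
    moreover have "spread N (z (Suc (t + n))) \<le> (1 - \<rho>) * spread N (z (Suc t)) + 2 * (\<Sum>q<n. e (Suc (t + q)))" for t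
    proof -
      have "spread N (\<lambda>i. \<Sum>j\<in>UNIV. transition W (Suc t) n $ i $ j *\<^sub>R z (Suc t) j) \<le> (1 - \<rho>) * spread N (z (Suc t))"
        using transition_entries_bounded_below[OF net, of "Suc t"] rho
        by (intro spread_contraction[OF N]) (auto simp: \<rho>_def n_def intro!: transition_row_sum ds)
      then show ?thesis using window[of t n] by simp
    qed
    ultimately have "(\<Sum>t<T. spread N (z (Suc t))) \<le> real n / \<rho> * (spread N (z (Suc 0)) + 4 * (\<Sum>t<T. e (Suc t)))"
      by (intro sum_le_of_delayed_contraction n rho) (auto intro!: e spread_nonneg[OF N])
    also have "\<dots> \<le> real n / \<rho> * (4 * (spread N (z (Suc 0)) + (\<Sum>t<T. e (Suc t))))"
      using rho by (intro mult_left_mono) (auto intro!: spread_nonneg[OF N])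
    finally show ?thesis by (simp add: sum.atLeast1_atMost_eq field_simps)
  qed
  show ?thesis
  proof (intro exI[of _ "4 * real n / \<rho>"] conjI allI impI)
    show "0 < 4 * real n / \<rho>" using n rho by simp
  qed (rule main, blast)
qed

section \<open>One step of mirror descent\<close>

lemma bregman_lower_bound:
  assumes "bregman_assumption TYPE('m::finite) X N \<Phi> d\<Phi> \<sigma>" "x \<in> X" "y \<in> X"
  shows "\<sigma> / 2 * (N (x - y))\<^sup>2 \<le> bregman \<Phi> d\<Phi> x y"
proof -
  have "\<Phi> x \<ge> \<Phi> y + d\<Phi> y \<bullet> (x - y) + \<sigma> / 2 * (N (x - y))\<^sup>2"
    using assms unfolding bregman_assumption_def by blast
  then show ?thesis by (simp add: bregman_def)
qed

lemma bregman_nonneg: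
  assumes "bregman_assumption TYPE('m::finite) X N \<Phi> d\<Phi> \<sigma>" "x \<in> X" "y \<in> X"
  shows "0 \<le> bregman \<Phi> d\<Phi> x y"
proof -
  have "0 < \<sigma>" using assms(1) by (simp add: bregman_assumption_def)
  then have "0 \<le> \<sigma> / 2 * (N (x - y))\<^sup>2" by simp
  then show ?thesis using bregman_lower_bound[OF assms] by linarith
qed

lemma bregman_three_points:
  "bregman \<Phi> d\<Phi> z y - bregman \<Phi> d\<Phi> z p - bregman \<Phi> d\<Phi> p y = (d\<Phi> p - d\<Phi> y) \<bullet> (z - p)"
  by (simp add: bregman_def inner_diff_left inner_diff_right)

text \<open>
  Moving from the minimizer \<open>p\<close> towards \<open>z\<close> by a fraction \<open>s\<close> does not decrease the objective.
  Divided by \<open>s\<close>, this inequality tends to the first-order condition as \<open>s\<close> tends to zero.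
\<close>

lemma mirror_step_optimality:
  fixes X :: "(real ^ 'n) set"
  assumes X: "convex X" and psi: "convex_on X \<psi>" and a: "0 < a"
    and diff: "(\<Phi> has_derivative (\<lambda>h. d\<Phi> p \<bullet> h)) (at p within X)"
    and arg: "is_arg_min (\<lambda>z. v \<bullet> z + 1 / a * bregman \<Phi> d\<Phi> z y + \<psi> z) (\<lambda>z. z \<in> X) p"
    and z: "z \<in> X"
  shows "a * (v \<bullet> (p - z) + \<psi> p - \<psi> z)
      \<le> bregman \<Phi> d\<Phi> z y - bregman \<Phi> d\<Phi> z p - bregman \<Phi> d\<Phi> p y"
proof -
  let ?c = "\<lambda>s. p + s *\<^sub>R (z - p)"
  have p: "p \<in> X" using arg by (simp add: is_arg_min_def)
  have c_in: "?c s \<in> X" if "s \<in> {0..1}" for s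
  proof -
    have "(1 - s) *\<^sub>R p + s *\<^sub>R z \<in> X" using that by (intro convexD[OF X p z]) auto
    then show ?thesis by (simp add: algebra_simps)
  qed
  define D where "D = d\<Phi> p \<bullet> (z - p)"
  have "((\<lambda>s. \<Phi> (?c s)) has_derivative (\<lambda>s. d\<Phi> p \<bullet> (s *\<^sub>R (z - p)))) (at 0 within {0..1})"
  proof (rule has_derivative_in_compose[where f = ?c and g = \<Phi> and g' = "\<lambda>h. d\<Phi> p \<bullet> h"])
    show "(?c has_derivative (\<lambda>s. s *\<^sub>R (z - p))) (at 0 within {0..1})"
      by (auto intro!: derivative_eq_intros)
    have "?c ` {0..1} \<subseteq> X" using c_in by blast
    from has_derivative_subset[OF diff this]
    show "(\<Phi> has_derivative (\<lambda>h. d\<Phi> p \<bullet> h)) (at (?c 0) within ?c ` {0..1})" by simp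
  qed
  moreover have "(\<lambda>s. d\<Phi> p \<bullet> (s *\<^sub>R (z - p))) = (*) D" by (simp add: fun_eq_iff D_def)
  ultimately have "((\<lambda>s. \<Phi> (?c s)) has_real_derivative D) (at 0 within {0..1})"
    by (simp only: has_field_derivative_def)
  then have lim: "((\<lambda>s. (\<Phi> (?c s) - \<Phi> p) / s) \<longlongrightarrow> D) (at_right 0)"
    by (simp add: has_field_derivative_iff at_within_Icc_at_right)
  define q where "q s = v \<bullet> (z - p) + \<psi> z - \<psi> p + 1 / a * ((\<Phi> (?c s) - \<Phi> p) / s - d\<Phi> y \<bullet> (z - p))" for s
  have nonneg: "0 \<le> q s" if s: "0 < s" "s < 1" for s
  proof -
    have cX: "?c s \<in> X" using s by (intro c_in) auto
    have "\<psi> ((1 - s) *\<^sub>R p + s *\<^sub>R z) \<le> (1 - s) * \<psi> p + s * \<psi> z"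
      using s by (intro convex_onD[OF psi] p z) auto
    moreover have "(1 - s) *\<^sub>R p + s *\<^sub>R z = ?c s" by (simp add: algebra_simps)
    ultimately have "\<psi> (?c s) - \<psi> p \<le> s * (\<psi> z - \<psi> p)" by (simp add: algebra_simps)
    moreover have "v \<bullet> p + 1 / a * bregman \<Phi> d\<Phi> p y + \<psi> p
        \<le> v \<bullet> ?c s + 1 / a * bregman \<Phi> d\<Phi> (?c s) y + \<psi> (?c s)"
      using arg cX unfolding is_arg_min_def by (meson linorder_not_le)
    moreover have "1 / a * bregman \<Phi> d\<Phi> (?c s) y - 1 / a * bregman \<Phi> d\<Phi> p y
        = 1 / a * (\<Phi> (?c s) - \<Phi> p - s * (d\<Phi> y \<bullet> (z - p)))"
      by (simp add: bregman_def inner_diff_right inner_add_right algebra_simps)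
    moreover have "v \<bullet> ?c s - v \<bullet> p = s * (v \<bullet> (z - p))" by (simp add: inner_add_right)
    ultimately have "0 \<le> s * (v \<bullet> (z - p)) + s * (\<psi> z - \<psi> p)
        + 1 / a * (\<Phi> (?c s) - \<Phi> p - s * (d\<Phi> y \<bullet> (z - p)))" by linarith
    also have "\<dots> = s * q s" using s a by (simp add: q_def field_simps)
    finally show ?thesis using s by (simp add: zero_le_mult_iff)
  qed
  have "(q \<longlongrightarrow> v \<bullet> (z - p) + \<psi> z - \<psi> p + 1 / a * (D - d\<Phi> y \<bullet> (z - p))) (at_right 0)"
    unfolding q_def by (intro tendsto_intros lim)
  moreover have "\<forall>\<^sub>F s in at_right 0. 0 \<le> q s"
    unfolding eventually_at_right_field using nonneg by (intro exI[of _ 1]) auto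
  ultimately have "0 \<le> v \<bullet> (z - p) + \<psi> z - \<psi> p + 1 / a * (D - d\<Phi> y \<bullet> (z - p))"
    by (intro tendsto_lowerbound) auto
  then have "a * (v \<bullet> (p - z) + \<psi> p - \<psi> z) \<le> D - d\<Phi> y \<bullet> (z - p)"
    using a by (simp add: inner_diff_right field_simps)
  then show ?thesis unfolding bregman_three_points D_def by (simp add: inner_diff_left)
qed

text \<open>
  Compared with the prox center \<open>y\<close> itself, the optimality condition has a Bregman term of second order in \<open>N (p - y)\<close>
  on one side and first-order terms on the other.
\<close>

lemma mirror_step_displacement:
  fixes X :: "(real ^ 'n) set"
  assumes N: "is_norm N" and X: "convex X" and psi: "convex_on X \<psi>" and a: "0 < a"
    and breg: "bregman_assumption TYPE('m::finite) X N \<Phi> d\<Phi> \<sigma>"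
    and arg: "is_arg_min (\<lambda>z. v \<bullet> z + 1 / a * bregman \<Phi> d\<Phi> z y + \<psi> z) (\<lambda>z. z \<in> X) p"
    and lip: "\<And>x y. x \<in> X \<Longrightarrow> y \<in> X \<Longrightarrow> \<bar>\<psi> x - \<psi> y\<bar> \<le> L * N (x - y)"
    and y: "y \<in> X"
    and L: "0 \<le> L"
  shows "N (p - y) \<le> a * (dual_norm N v + L) / \<sigma>"
proof -
  have sigma: "\<sigma> > 0" using breg by (simp add: bregman_assumption_def)
  have p: "p \<in> X" using arg by (simp add: is_arg_min_def)
  have diff: "(\<Phi> has_derivative (\<lambda>h. d\<Phi> p \<bullet> h)) (at p within X)"
    using breg p by (simp add: bregman_assumption_def)
  define d where "d = N (p - y)"
  have d: "d \<ge> 0" unfolding d_def by (rule is_norm_nonneg[OF N])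
  have "a * (v \<bullet> (p - y) + \<psi> p - \<psi> y) \<le> - bregman \<Phi> d\<Phi> y p - bregman \<Phi> d\<Phi> p y"
    using mirror_step_optimality[OF X psi a diff arg y] by (simp add: bregman_def)
  also have "\<dots> \<le> - (\<sigma> * d\<^sup>2)"
    using bregman_lower_bound[OF breg p y] bregman_lower_bound[OF breg y p]
      is_norm_minus_commute[OF N, of y p] by (simp add: d_def)
  finally have "\<sigma> * d\<^sup>2 \<le> a * (\<psi> y - \<psi> p - v \<bullet> (p - y))" by (simp add: algebra_simps)
  also have "\<dots> \<le> a * (L * d + dual_norm N v * d)"
  proof (rule mult_left_mono)
    have "- (v \<bullet> (p - y)) \<le> dual_norm N v * d"
      using abs_inner_le_dual_norm[OF N, of v "p - y"] unfolding d_def by linarith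
    moreover have "\<psi> y - \<psi> p \<le> L * d"
      using lip[OF p y] unfolding d_def by linarith
    ultimately show "\<psi> y - \<psi> p - v \<bullet> (p - y) \<le> L * d + dual_norm N v * d" by linarith
  qed (use a in simp)
  finally have *: "d * (\<sigma> * d) \<le> d * (a * (dual_norm N v + L))"
    by (simp add: power2_eq_square algebra_simps)
  have "\<sigma> * d \<le> a * (dual_norm N v + L)"
  proof (cases "d = 0")
    case True
    then show ?thesis using a L is_norm_nonneg[OF is_norm_dual_norm[OF N], of v] by simp
  next
    case False
    with d * show ?thesis by simp
  qed
  then show ?thesis using sigma by (simp add: d_def field_simps)
qed

section \<open>Exponential moments of truncated martingale differences\<close>

lemma exp_le_quadratic: "exp u \<le> 1 + u + u\<^sup>2 * exp \<bar>u\<bar>" for u :: real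
proof -
  obtain t where t: "\<bar>t\<bar> \<le> \<bar>u\<bar>" "exp u = (\<Sum>m<2. u ^ m / fact m) + exp t / fact 2 * u ^ 2"
    using Maclaurin_exp_le[of u 2] by blast
  have "exp t / 2 \<le> exp \<bar>u\<bar>" using t(1) exp_le_cancel_iff[of t "\<bar>u\<bar>"] exp_gt_zero[of "\<bar>u\<bar>"] by linarith
  then have "exp t / 2 * u\<^sup>2 \<le> exp \<bar>u\<bar> * u\<^sup>2" by (intro mult_right_mono) auto
  then show ?thesis using t(2) by (simp add: numeral_2_eq_2 mult.commute)
qed

lemma powr_le_exp_half:
  fixes p :: real
  assumes "p > 0"
  obtains c where "c \<ge> 1" "\<And>r. r \<ge> 0 \<Longrightarrow> r powr p \<le> c * exp (r / 2)"
proof -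
  define n where "n = nat \<lceil>p\<rceil>"
  have n: "p \<le> real n" "n \<ge> 1" using assms by (auto simp: n_def, linarith)
  have "r powr p \<le> (1 + real (2 * n) ^ n) * exp (r / 2)" if r: "r \<ge> 0" for r
  proof (cases "r \<le> 1")
    case True
    then have "r powr p \<le> 1" using r assms by (simp add: powr_le1)
    also have "1 \<le> 1 * exp (r / 2)" using r by simp
    also have "\<dots> \<le> (1 + real (2 * n) ^ n) * exp (r / 2)" by (intro mult_right_mono) auto
    finally show ?thesis .
  next
    case False
    then have "r powr p \<le> r powr real n" using n by (intro powr_mono) auto
    also have "\<dots> = r ^ n" using False by (simp add: powr_realpow)
    also have "\<dots> = (real (2 * n) * (r / real (2 * n))) ^ n" using n by simp
    also have "\<dots> \<le> (real (2 * n) * exp (r / real (2 * n))) ^ n"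
    proof (intro power_mono mult_left_mono)
      show "r / real (2 * n) \<le> exp (r / real (2 * n))"
        using exp_ge_add_one_self[of "r / real (2 * n)"] by linarith
    qed (use r in auto)
    also have "\<dots> = real (2 * n) ^ n * exp (r / 2)"
      using n by (simp add: power_mult_distrib flip: exp_of_nat_mult)
    also have "\<dots> \<le> (1 + real (2 * n) ^ n) * exp (r / 2)" by (intro mult_right_mono) auto
    finally show ?thesis .
  qed
  then show ?thesis by (intro that[of "1 + real (2 * n) ^ n"]) auto
qed

text \<open>
  Above the truncation level the left-hand side vanishes, while the right-hand side stays nonnegative
  because \<open>1 + u + u\<^sup>2 \<ge> 0\<close>.  So the truncated exponential is bounded with the untruncated linear
  term \<open>u\<close>, whose conditional mean is zero, and truncation introduces no bias.  For \<open>\<theta> > 1\<close> the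
  noise need not have exponential moments; below the level \<open>b\<close>, however, \<open>w / b powr (1 - 1 / \<theta>)\<close> is at
  most \<open>w powr (1 / \<theta>)\<close>, and this is what the factor \<open>\<Lambda>\<close> provides.
\<close>

lemma truncated_exp_le:
  fixes \<theta> :: real
  assumes theta: "1 / 2 \<le> \<theta>"
  shows "\<exists>C\<ge>0. \<forall>w b \<Lambda> \<beta> u. 0 \<le> w \<longrightarrow> 0 \<le> b \<longrightarrow> 1 \<le> \<Lambda> \<longrightarrow> (1 \<le> \<theta> \<longrightarrow> b powr (1 - 1 / \<theta>) \<le> \<Lambda>) \<longrightarrow>
       0 \<le> \<beta> \<longrightarrow> \<beta> \<le> 1 \<longrightarrow> \<bar>u\<bar> \<le> \<beta> / (2 * \<Lambda>) * w \<longrightarrow>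
       (if w \<le> b then exp u else 0) \<le> 1 + u + C * \<beta>\<^sup>2 * exp (w powr (1 / \<theta>))"
proof -
  obtain c where c: "c \<ge> 1" "\<And>r. r \<ge> 0 \<Longrightarrow> r powr (2 * \<theta>) \<le> c * exp (r / 2)"
    using powr_le_exp_half[of "2 * \<theta>"] theta by auto
  have main: "(if w \<le> b then exp u else 0) \<le> 1 + u + c * exp (1 / 2) * \<beta>\<^sup>2 * exp (w powr (1 / \<theta>))"
    if w: "0 \<le> w" and b: "0 \<le> b" and Lam: "1 \<le> \<Lambda>" "1 \<le> \<theta> \<Longrightarrow> b powr (1 - 1 / \<theta>) \<le> \<Lambda>"
      and beta: "0 \<le> \<beta>" "\<beta> \<le> 1" and u: "\<bar>u\<bar> \<le> \<beta> / (2 * \<Lambda>) * w" for w b \<Lambda> \<beta> u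
  proof -
    define r where "r = w powr (1 / \<theta>)"
    have r: "r \<ge> 0" by (simp add: r_def)
    have rp: "r powr \<theta> = w" using theta w by (simp add: r_def powr_powr)
    have "w\<^sup>2 = r powr (2 * \<theta>)"
      unfolding rp[symmetric] by (simp add: power2_eq_square flip: powr_add)
    then have w2: "w\<^sup>2 \<le> c * exp (r / 2)" using c(2)[OF r] by simp
    have "\<beta> / (2 * \<Lambda>) \<le> \<beta> / 1" using beta Lam(1) by (intro divide_left_mono) auto
    then have "\<beta> / (2 * \<Lambda>) * w \<le> \<beta> * w" using w by (intro mult_right_mono) auto
    then have "\<bar>u\<bar> \<le> \<beta> * w" using u by linarith
    then have "\<bar>u\<bar>\<^sup>2 \<le> (\<beta> * w)\<^sup>2" by (intro power_mono) auto
    then have "u\<^sup>2 \<le> \<beta>\<^sup>2 * w\<^sup>2" by (simp add: power_mult_distrib)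
    also have "\<dots> \<le> \<beta>\<^sup>2 * (c * exp (r / 2))" by (intro mult_left_mono w2) auto
    finally have u2: "u\<^sup>2 \<le> \<beta>\<^sup>2 * (c * exp (r / 2))" .
    show ?thesis
    proof (cases "w \<le> b")
      case True
      have "\<beta> / (2 * \<Lambda>) * w \<le> w / (2 * \<Lambda>)"
        using beta Lam(1) w by (simp add: divide_right_mono mult_left_le_one_le)
      also have "w / (2 * \<Lambda>) \<le> 1 / 2 + r / 2"
      proof (cases "\<theta> < 1")
        case True
        have "w \<le> 1 + r"
        proof (cases "w \<le> 1")
          case False
          then have "w powr 1 \<le> w powr (1 / \<theta>)" using True theta by (intro powr_mono) auto
          then show ?thesis using False by (simp add: r_def)
        qed (use r in linarith)
        moreover have "w / (2 * \<Lambda>) \<le> w / 2" using Lam(1) w by (intro divide_left_mono) auto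
        ultimately show ?thesis by simp
      next
        case False
        have "w = r * w powr (1 - 1 / \<theta>)"
          using w by (cases "w = 0") (auto simp: r_def simp flip: powr_add)
        also have "\<dots> \<le> r * b powr (1 - 1 / \<theta>)"
          using False r w \<open>w \<le> b\<close> by (intro mult_left_mono powr_mono2) auto
        also have "\<dots> \<le> r * \<Lambda>" using Lam(2) False r by (intro mult_left_mono) auto
        finally have "w / (2 * \<Lambda>) \<le> r / 2" using Lam(1) by (simp add: field_simps)
        then show ?thesis by simp
      qed
      finally have "\<bar>u\<bar> \<le> 1 / 2 + r / 2" using u by linarith
      then have "u\<^sup>2 * exp \<bar>u\<bar> \<le> \<beta>\<^sup>2 * (c * exp (r / 2)) * exp (1 / 2 + r / 2)"
        using u2 c(1) by (intro mult_mono) auto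
      also have "\<dots> = c * exp (1 / 2) * \<beta>\<^sup>2 * (exp (r / 2) * exp (r / 2))"
        by (simp add: exp_add)
      also have "exp (r / 2) * exp (r / 2) = exp r" by (simp flip: exp_add)
      finally show ?thesis using exp_le_quadratic[of u] True by (simp add: r_def)
    next
      case False
      have "0 \<le> (u + 1 / 2)\<^sup>2" by simp
      then have "0 \<le> 1 + u + u\<^sup>2" by (simp add: power2_eq_square algebra_simps)
      moreover have "\<beta>\<^sup>2 * (c * exp (r / 2)) \<le> \<beta>\<^sup>2 * (c * (exp (1 / 2) * exp r))"
      proof -
        have "exp (r / 2) \<le> exp (1 / 2 + r)" using r by simp
        then show ?thesis using c(1) by (intro mult_left_mono) (auto simp: exp_add)
      qed
      ultimately show ?thesis using u2 False by (simp add: r_def mult_ac)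
    qed
  qed
  show ?thesis
  proof (intro exI[of _ "c * exp (1 / 2)"] conjI allI impI)
    show "0 \<le> c * exp (1 / 2)" using c(1) by simp
  qed (rule main; blast)
qed

text \<open>
  The weight \<open>P\<close> is where the exponential of the past noise enters; it passes through the conditional expectation.
\<close>

lemma exp_weibull_integrable:
  fixes w :: "'w \<Rightarrow> real"
  assumes M: "prob_space M" and F: "subalgebra M F" and w: "w \<in> borel_measurable M"
    and noise: "AE \<omega> in M. nn_cond_exp M F (\<lambda>\<omega>. ennreal (exp (w \<omega> powr p))) \<omega> \<le> 2"
    and P: "P \<in> borel_measurable F" "\<And>\<omega>. 0 \<le> P \<omega>" "\<And>\<omega>. P \<omega> \<le> cP"
  shows "integrable M (\<lambda>\<omega>. P \<omega> * exp (w \<omega> powr p))"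
    and "(\<integral>\<omega>. P \<omega> * exp (w \<omega> powr p) \<partial>M) \<le> 2 * (\<integral>\<omega>. P \<omega> \<partial>M)"
proof -
  interpret prob_space M by (rule M)
  interpret finite_measure_subalgebra M F by standard (rule F)
  note [measurable] = w P(1) measurable_from_subalg[OF F P(1)]
  have intP: "integrable M P"
    by (rule integrable_const_bound[of _ cP]) (use P in \<open>auto\<close>)
  have "(\<integral>\<^sup>+\<omega>. ennreal (P \<omega> * exp (w \<omega> powr p)) \<partial>M)
      = (\<integral>\<^sup>+\<omega>. ennreal (P \<omega>) * ennreal (exp (w \<omega> powr p)) \<partial>M)"
    by (simp add: ennreal_mult P)
  also have "\<dots> = (\<integral>\<^sup>+\<omega>. ennreal (P \<omega>) * nn_cond_exp M F (\<lambda>\<omega>. ennreal (exp (w \<omega> powr p))) \<omega> \<partial>M)"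
    by (intro nn_cond_exp_intg[symmetric]) measurable
  also have "\<dots> \<le> (\<integral>\<^sup>+\<omega>. ennreal (P \<omega>) * 2 \<partial>M)"
  proof (rule nn_integral_mono_AE)
    show "AE \<omega> in M. ennreal (P \<omega>) * nn_cond_exp M F (\<lambda>\<omega>. ennreal (exp (w \<omega> powr p))) \<omega> \<le> ennreal (P \<omega>) * 2"
      using noise by eventually_elim (rule mult_left_mono, simp_all)
  qed
  also have "\<dots> = ennreal (\<integral>\<omega>. P \<omega> \<partial>M) * 2"
    by (subst nn_integral_multc) (auto simp: nn_integral_eq_integral[OF intP] P)
  also have "\<dots> = ennreal (2 * (\<integral>\<omega>. P \<omega> \<partial>M))"
    by (simp add: ennreal_mult P integral_nonneg_AE mult.commute)
  finally have le: "(\<integral>\<^sup>+\<omega>. ennreal (P \<omega> * exp (w \<omega> powr p)) \<partial>M) \<le> ennreal (2 * (\<integral>\<omega>. P \<omega> \<partial>M))" .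
  show int: "integrable M (\<lambda>\<omega>. P \<omega> * exp (w \<omega> powr p))"
  proof (rule integrableI_nonneg)
    show "(\<integral>\<^sup>+\<omega>. ennreal (P \<omega> * exp (w \<omega> powr p)) \<partial>M) < \<infinity>"
      by (rule le_less_trans[OF le]) simp
  qed (use P in auto)
  show "(\<integral>\<omega>. P \<omega> * exp (w \<omega> powr p) \<partial>M) \<le> 2 * (\<integral>\<omega>. P \<omega> \<partial>M)"
    using le P(2) by (subst (asm) nn_integral_eq_integral[OF int]) (auto simp: integral_nonneg_AE)
qed

text \<open>
  The conditional mean is given componentwise, so the inner product is expanded into components, each a product of a
  bounded predictable factor and a martingale difference.
\<close>

lemma martingale_difference_integral_zero:
  fixes \<xi> v :: "'w \<Rightarrow> real ^ 'n"
  assumes M: "prob_space M" and F: "subalgebra M F"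
    and xi: "\<xi> \<in> borel_measurable M" "integrable M (\<lambda>\<omega>. norm (\<xi> \<omega>))"
    and mean: "\<And>k. AE \<omega> in M. real_cond_exp M F (\<lambda>\<omega>. \<xi> \<omega> $ k) \<omega> = 0"
    and v: "v \<in> borel_measurable F" "\<And>\<omega>. norm (v \<omega>) \<le> cv"
  shows "integrable M (\<lambda>\<omega>. \<xi> \<omega> \<bullet> v \<omega>)" and "(\<integral>\<omega>. \<xi> \<omega> \<bullet> v \<omega> \<partial>M) = 0"
proof -
  interpret prob_space M by (rule M)
  interpret finite_measure_subalgebra M F by standard (rule F)
  have comp [measurable]: "(\<lambda>\<omega>. \<xi> \<omega> $ k) \<in> borel_measurable M" "(\<lambda>\<omega>. v \<omega> $ k) \<in> borel_measurable F" for k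
    using borel_measurable_inner[OF xi(1) borel_measurable_const[of "axis k 1"]]
      borel_measurable_inner[OF v(1) borel_measurable_const[of "axis k 1"]]
    by (simp_all add: inner_axis)
  have [measurable]: "(\<lambda>\<omega>. v \<omega> $ k) \<in> borel_measurable M" for k
    by (rule measurable_from_subalg[OF F]) (rule comp)
  have int: "integrable M (\<lambda>\<omega>. v \<omega> $ k * \<xi> \<omega> $ k)" for k
  proof (rule Bochner_Integration.integrable_bound)
    show "integrable M (\<lambda>\<omega>. cv * norm (\<xi> \<omega>))" using xi(2) by simp
    have "\<bar>v \<omega> $ k * \<xi> \<omega> $ k\<bar> \<le> cv * norm (\<xi> \<omega>)" for \<omega>
      unfolding abs_mult using component_le_norm_cart[of "v \<omega>" k] v(2)[of \<omega>]
      by (intro mult_mono component_le_norm_cart) (auto intro: order_trans[OF norm_ge_zero])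
    then show "AE \<omega> in M. norm (v \<omega> $ k * \<xi> \<omega> $ k) \<le> norm (cv * norm (\<xi> \<omega>))"
      by (intro AE_I2) (auto intro: order_trans[OF _ abs_ge_self])
  qed measurable
  have zero: "(\<integral>\<omega>. v \<omega> $ k * \<xi> \<omega> $ k \<partial>M) = 0" for k
  proof -
    have "(\<integral>\<omega>. v \<omega> $ k * \<xi> \<omega> $ k \<partial>M) = (\<integral>\<omega>. v \<omega> $ k * real_cond_exp M F (\<lambda>\<omega>. \<xi> \<omega> $ k) \<omega> \<partial>M)"
      by (rule real_cond_exp_intg(2)[symmetric, OF int]) measurable
    also have "\<dots> = (\<integral>\<omega>. 0 \<partial>M)"
      by (rule integral_cong_AE) (use mean[of k] in \<open>auto elim!: eventually_mono\<close>)
    finally show ?thesis by simp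
  qed
  have inner: "\<xi> \<omega> \<bullet> v \<omega> = (\<Sum>k\<in>UNIV. v \<omega> $ k * \<xi> \<omega> $ k)" for \<omega>
    by (simp add: inner_vec_def mult.commute)
  show "integrable M (\<lambda>\<omega>. \<xi> \<omega> \<bullet> v \<omega>)" unfolding inner using int by simp
  show "(\<integral>\<omega>. \<xi> \<omega> \<bullet> v \<omega> \<partial>M) = 0" unfolding inner by (simp add: Bochner_Integration.integral_sum int zero)
qed

text \<open>
  Markov's inequality for \<open>exp (w powr p)\<close>.
\<close>

lemma weibull_tail:
  fixes w :: "'w \<Rightarrow> real"
  assumes M: "prob_space M" and F: "subalgebra M F" and w: "w \<in> borel_measurable M"
    and noise: "AE \<omega> in M. nn_cond_exp M F (\<lambda>\<omega>. ennreal (exp (w \<omega> powr p))) \<omega> \<le> 2"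
    and b: "0 \<le> b" "0 < p"
  shows "measure M {\<omega> \<in> space M. b < w \<omega>} \<le> 2 * exp (- (b powr p))"
proof -
  interpret prob_space M by (rule M)
  let ?A = "{\<omega> \<in> space M. b < w \<omega>}"
  have A [measurable]: "?A \<in> sets M" using w by measurable
  note exp_w = exp_weibull_integrable[OF M F w noise, of "\<lambda>_. 1" 1, simplified]
  have "exp (b powr p) * measure M ?A = (\<integral>\<omega>. exp (b powr p) * indicator ?A \<omega> \<partial>M)" by simp
  also have "\<dots> \<le> (\<integral>\<omega>. exp (w \<omega> powr p) \<partial>M)"
  proof (rule integral_mono)
    show "integrable M (\<lambda>\<omega>. exp (b powr p) * indicator ?A \<omega>)"
      by (intro integrable_mult_right integrable_real_indicator) (auto simp: emeasure_eq_measure)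
    fix \<omega>
    show "exp (b powr p) * indicator ?A \<omega> \<le> exp (w \<omega> powr p)"
      using b powr_mono2[of p b "w \<omega>"] by (cases "\<omega> \<in> ?A") auto
  qed (rule exp_w)
  also have "\<dots> \<le> 2" using exp_w(2) by (simp add: prob_space)
  finally show ?thesis by (simp add: exp_minus field_simps)
qed

text \<open>
  The usual exponential supermartingale argument: one more factor multiplies the expectation by at most \<open>1 + 2 * K\<close>, since
  the linear term integrates to zero against the past and the conditional exponential moment is at most \<open>2\<close>.  Truncation
  makes the product bounded, so all integrals exist even when the noise has no exponential moments.
\<close>

lemma truncated_exp_martingale:
  fixes \<xi> v :: "nat \<Rightarrow> 'w \<Rightarrow> real ^ 'n"
  assumes M: "prob_space M" and filt: "filtration (space M) Fil" and sub: "\<And>t. subalgebra M (Fil t)"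
    and xi: "\<And>t. t \<ge> 1 \<Longrightarrow> \<xi> t \<in> borel_measurable (Fil t)"
    and v: "\<And>t. t \<ge> 1 \<Longrightarrow> v t \<in> borel_measurable (Fil (t - 1))" "\<And>t \<omega>. t \<ge> 1 \<Longrightarrow> norm (v t \<omega>) \<le> cv"
    and w: "\<And>t. t \<ge> 1 \<Longrightarrow> w t \<in> borel_measurable (Fil t)" "\<And>t \<omega>. 0 \<le> w t \<omega>"
    and norm_xi: "\<And>t \<omega>. norm (\<xi> t \<omega>) \<le> cw * w t \<omega>"
    and mean: "\<And>t k. t \<ge> 1 \<Longrightarrow> AE \<omega> in M. real_cond_exp M (Fil (t - 1)) (\<lambda>\<omega>. \<xi> t \<omega> $ k) \<omega> = 0"
    and noise: "\<And>t. t \<ge> 1 \<Longrightarrow>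
      AE \<omega> in M. nn_cond_exp M (Fil (t - 1)) (\<lambda>\<omega>. ennreal (exp (w t \<omega> powr (1 / \<theta>)))) \<omega> \<le> 2"
    and theta: "0 < \<theta>" and K: "0 \<le> K" and cw: "0 \<le> cw"
    and trunc: "\<And>t \<omega>. t \<ge> 1 \<Longrightarrow> (if w t \<omega> \<le> b then exp (\<xi> t \<omega> \<bullet> v t \<omega>) else 0)
        \<le> 1 + \<xi> t \<omega> \<bullet> v t \<omega> + K * exp (w t \<omega> powr (1 / \<theta>))"
  defines "P \<equiv> \<lambda>T \<omega>. \<Prod>t=1..T. if w t \<omega> \<le> b then exp (\<xi> t \<omega> \<bullet> v t \<omega>) else 0"
  shows "integrable M (P T)" and "(\<integral>\<omega>. P T \<omega> \<partial>M) \<le> (1 + 2 * K) ^ T"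
proof -
  interpret prob_space M by (rule M)
  have Fil_le: "f \<in> borel_measurable (Fil t)" if "f \<in> borel_measurable (Fil s)" "s \<le> t"
    for f :: "'w \<Rightarrow> 'z::topological_space" and s t
  proof -
    have "subalgebra (Fil t) (Fil s)"
      using filtration.space_F[OF filt] filtration.sets_F_mono[OF filt that(2)] by (simp add: subalgebra_def)
    then show ?thesis using that(1) by (rule measurable_from_subalg)
  qed
  have Fil_M: "f \<in> borel_measurable M" if "f \<in> borel_measurable (Fil t)"
    for f :: "'w \<Rightarrow> 'z::topological_space" and t
    using sub that by (rule measurable_from_subalg)
  define Y where "Y t \<omega> = (if w t \<omega> \<le> b then exp (\<xi> t \<omega> \<bullet> v t \<omega>) else 0)" for t \<omega>
  have P_eq: "P T \<omega> = (\<Prod>t=1..T. Y t \<omega>)" for T \<omega> by (simp add: P_def Y_def)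
  have Y_meas: "Y t \<in> borel_measurable (Fil t)" if "t \<ge> 1" for t
  proof -
    have [measurable]: "w t \<in> borel_measurable (Fil t)" "\<xi> t \<in> borel_measurable (Fil t)"
      "v t \<in> borel_measurable (Fil t)"
      using w(1)[OF that] xi[OF that] Fil_le[OF v(1)[OF that]] by auto
    show ?thesis unfolding Y_def by measurable
  qed
  have P_meas: "P T \<in> borel_measurable (Fil T)" for T
    unfolding P_eq[abs_def] by (intro borel_measurable_prod Fil_le[OF Y_meas]) auto
  have Y_nonneg: "0 \<le> Y t \<omega>" for t \<omega> by (simp add: Y_def)
  have P_nonneg: "0 \<le> P T \<omega>" for T \<omega> unfolding P_eq by (intro prod_nonneg Y_nonneg)
  define q where "q = exp (cw * \<bar>b\<bar> * cv)"
  have cv: "0 \<le> cv" using v(2)[of 1] norm_ge_zero order_trans by blast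
  have Y_le: "Y t \<omega> \<le> q" if "t \<ge> 1" for t \<omega>
  proof (cases "w t \<omega> \<le> b")
    case True
    have "\<xi> t \<omega> \<bullet> v t \<omega> \<le> norm (\<xi> t \<omega>) * norm (v t \<omega>)" by (rule norm_cauchy_schwarz)
    also have "\<dots> \<le> (cw * \<bar>b\<bar>) * cv"
    proof (intro mult_mono v(2) that)
      have "cw * w t \<omega> \<le> cw * \<bar>b\<bar>" using True cw by (intro mult_left_mono) auto
      then show "norm (\<xi> t \<omega>) \<le> cw * \<bar>b\<bar>" using norm_xi[of t \<omega>] by linarith
    qed (use cw in auto)
    finally show ?thesis using True by (simp add: Y_def q_def)
  qed (simp add: Y_def q_def)
  have P_le: "P T \<omega> \<le> q ^ T" for T \<omega>
    unfolding P_eq using prod_mono[of "{1..T}" "\<lambda>t. Y t \<omega>" "\<lambda>_. q"] Y_le Y_nonneg by simp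
  have P_int: "integrable M (P T)" for T
    by (rule integrable_const_bound[of _ "q ^ T"]) (use P_nonneg P_le Fil_M[OF P_meas] in auto)
  obtain c where c: "c \<ge> 1" "\<And>r. r \<ge> 0 \<Longrightarrow> r powr \<theta> \<le> c * exp (r / 2)"
    using powr_le_exp_half[OF theta] by blast
  have xi_int: "integrable M (\<lambda>\<omega>. norm (\<xi> t \<omega>))" if t: "t \<ge> 1" for t
  proof (rule Bochner_Integration.integrable_bound)
    show "integrable M (\<lambda>\<omega>. cw * (c * exp (w t \<omega> powr (1 / \<theta>))))"
      using exp_weibull_integrable(1)[OF M sub Fil_M[OF w(1)[OF t]] noise[OF t], of "\<lambda>_. 1" 1] by simp
    show "(\<lambda>\<omega>. norm (\<xi> t \<omega>)) \<in> borel_measurable M" using Fil_M[OF xi[OF t]] by simp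
    have "norm (\<xi> t \<omega>) \<le> cw * (c * exp (w t \<omega> powr (1 / \<theta>)))" for \<omega>
    proof -
      have "w t \<omega> = (w t \<omega> powr (1 / \<theta>)) powr \<theta>" using w(2) theta by (simp add: powr_powr)
      also have "\<dots> \<le> c * exp (w t \<omega> powr (1 / \<theta>) / 2)" by (rule c) simp
      also have "\<dots> \<le> c * exp (w t \<omega> powr (1 / \<theta>))" using c(1) by (intro mult_left_mono) auto
      finally have "cw * w t \<omega> \<le> cw * (c * exp (w t \<omega> powr (1 / \<theta>)))" using cw by (rule mult_left_mono)
      then show ?thesis using norm_xi[of t \<omega>] by linarith
    qed
    then show "AE \<omega> in M. norm (norm (\<xi> t \<omega>)) \<le> norm (cw * (c * exp (w t \<omega> powr (1 / \<theta>))))"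
      by (intro AE_I2) (auto intro: order_trans[OF _ abs_ge_self])
  qed
  show "integrable M (P T)" by (rule P_int)
  show "(\<integral>\<omega>. P T \<omega> \<partial>M) \<le> (1 + 2 * K) ^ T"
  proof (induction T)
    case 0
    then show ?case by (simp add: P_eq prob_space)
  next
    case (Suc T)
    let ?v = "\<lambda>\<omega>. P T \<omega> *\<^sub>R v (Suc T) \<omega>"
    let ?E = "\<lambda>\<omega>. exp (w (Suc T) \<omega> powr (1 / \<theta>))"
    have v_meas: "?v \<in> borel_measurable (Fil T)"
      using P_meas[of T] v(1)[of "Suc T"] by simp
    have v_le: "norm (?v \<omega>) \<le> q ^ T * cv" for \<omega>
      using P_nonneg[of T \<omega>] P_le[of T \<omega>] v(2)[of "Suc T" \<omega>] cv by (auto intro!: mult_mono)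
    have xi_M: "\<xi> (Suc T) \<in> borel_measurable M" using Fil_M[OF xi] by simp
    have mean': "AE \<omega> in M. real_cond_exp M (Fil T) (\<lambda>\<omega>. \<xi> (Suc T) \<omega> $ k) \<omega> = 0" for k
      using mean[of "Suc T" k] by simp
    note lin = martingale_difference_integral_zero[OF M sub xi_M xi_int mean' v_meas v_le, simplified]
    have w_M: "w (Suc T) \<in> borel_measurable M" using Fil_M[OF w(1)] by simp
    have noise': "AE \<omega> in M. nn_cond_exp M (Fil T) (\<lambda>\<omega>. ennreal (?E \<omega>)) \<omega> \<le> 2"
      using noise[of "Suc T"] by simp
    note quad = exp_weibull_integrable[OF M sub w_M noise' P_meas P_nonneg P_le]
    have "(\<integral>\<omega>. P (Suc T) \<omega> \<partial>M)
        \<le> (\<integral>\<omega>. P T \<omega> + P T \<omega> * (\<xi> (Suc T) \<omega> \<bullet> v (Suc T) \<omega>) + K * (P T \<omega> * ?E \<omega>) \<partial>M)"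
    proof (rule integral_mono[OF P_int])
      show "integrable M (\<lambda>\<omega>. P T \<omega> + P T \<omega> * (\<xi> (Suc T) \<omega> \<bullet> v (Suc T) \<omega>) + K * (P T \<omega> * ?E \<omega>))"
        using P_int lin(1) quad(1) by simp
      fix \<omega>
      have "Y (Suc T) \<omega> \<le> 1 + \<xi> (Suc T) \<omega> \<bullet> v (Suc T) \<omega> + K * ?E \<omega>"
        unfolding Y_def by (rule trunc) simp
      from mult_left_mono[OF this P_nonneg[of T \<omega>]]
      show "P (Suc T) \<omega> \<le> P T \<omega> + P T \<omega> * (\<xi> (Suc T) \<omega> \<bullet> v (Suc T) \<omega>) + K * (P T \<omega> * ?E \<omega>)"
        by (simp add: P_eq algebra_simps)
    qed
    also have "\<dots> = (\<integral>\<omega>. P T \<omega> \<partial>M) + K * (\<integral>\<omega>. P T \<omega> * ?E \<omega> \<partial>M)"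
      using P_int lin quad(1) by simp
    also have "\<dots> \<le> (\<integral>\<omega>. P T \<omega> \<partial>M) + K * (2 * (\<integral>\<omega>. P T \<omega> \<partial>M))"
      by (intro add_left_mono mult_left_mono quad(2) K)
    also have "\<dots> = (1 + 2 * K) * (\<integral>\<omega>. P T \<omega> \<partial>M)" by (simp add: algebra_simps)
    also have "\<dots> \<le> (1 + 2 * K) * (1 + 2 * K) ^ T" using Suc K by (intro mult_left_mono) auto
    finally show ?case by simp
  qed
qed

lemma truncated_exp_martingale_tail:
  fixes u w :: "nat \<Rightarrow> 'w \<Rightarrow> real"
  assumes M: "prob_space M"
    and int: "integrable M (\<lambda>\<omega>. \<Prod>t=1..T. if w t \<omega> \<le> b then exp (u t \<omega>) else 0)"
    and le: "(\<integral>\<omega>. (\<Prod>t=1..T. if w t \<omega> \<le> b then exp (u t \<omega>) else 0) \<partial>M) \<le> L"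
    and A: "{\<omega> \<in> space M. (\<forall>t\<in>{1..T}. w t \<omega> \<le> b) \<and> c < (\<Sum>t=1..T. u t \<omega>)} \<in> sets M" (is "?A \<in> _")
  shows "measure M {\<omega> \<in> space M. (\<forall>t\<in>{1..T}. w t \<omega> \<le> b) \<and> c < (\<Sum>t=1..T. u t \<omega>)} \<le> L * exp (- c)"
proof -
  interpret prob_space M by (rule M)
  let ?P = "\<lambda>\<omega>. \<Prod>t=1..T. if w t \<omega> \<le> b then exp (u t \<omega>) else 0"
  have "exp c * measure M ?A = (\<integral>\<omega>. exp c * indicator ?A \<omega> \<partial>M)" using A by simp
  also have "\<dots> \<le> (\<integral>\<omega>. ?P \<omega> \<partial>M)"
  proof (rule integral_mono[OF _ int])
    show "integrable M (\<lambda>\<omega>. exp c * indicator ?A \<omega>)"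
      using A by (intro integrable_mult_right integrable_real_indicator) (auto simp: emeasure_eq_measure)
    fix \<omega>
    show "exp c * indicator ?A \<omega> \<le> ?P \<omega>"
    proof (cases "\<omega> \<in> ?A")
      case True
      then have "?P \<omega> = exp (\<Sum>t=1..T. u t \<omega>)" by (simp add: exp_sum)
      then show ?thesis using True by simp
    qed (auto intro!: prod_nonneg)
  qed
  finally show ?thesis using le by (simp add: exp_minus field_simps)
qed

section \<open>The energy inequality along one trajectory\<close>

lemma bregman_convex_combination:
  fixes a :: "'m::finite \<Rightarrow> real"
  assumes "bregman_assumption TYPE('m) X N \<Phi> d\<Phi> \<sigma>" "x \<in> X"
    and "\<And>j. y j \<in> X" "\<And>j. 0 \<le> a j" "(\<Sum>j\<in>UNIV. a j) = 1"
  shows "bregman \<Phi> d\<Phi> x (\<Sum>j\<in>UNIV. a j *\<^sub>R y j) \<le> (\<Sum>j\<in>UNIV. a j * bregman \<Phi> d\<Phi> x (y j))"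
  using assms unfolding bregman_assumption_def by blast

text \<open>
  The optimality condition controls the linearized loss at the new point \<open>p\<close>.  To compare with \<open>x'\<close> instead,
  the loss is moved from \<open>p\<close> to \<open>x\<close> along the subgradient and from \<open>x\<close> to \<open>x'\<close> by Lipschitz continuity.  The noise is
  split at the prox center, because \<open>\<xi> \<bullet> (y - z)\<close> is a martingale difference, whereas \<open>\<xi> \<bullet> (p - y)\<close> is a correlated
  term of second order: the displacement \<open>p - y\<close> itself is proportional to \<open>a\<close>.
\<close>

lemma mirror_step_progress:
  fixes X :: "(real ^ 'n) set"
  assumes N: "is_norm N" and X: "convex X" and psi: "convex_on X \<psi>" and a: "0 < a"
    and breg: "bregman_assumption TYPE('m::finite) X N \<Phi> d\<Phi> \<sigma>"
    and arg: "is_arg_min (\<lambda>z. (g - \<xi>) \<bullet> z + 1 / a * bregman \<Phi> d\<Phi> z y + \<psi> z) (\<lambda>z. z \<in> X) p"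
    and lip: "\<And>x y. x \<in> X \<Longrightarrow> y \<in> X \<Longrightarrow> \<bar>\<psi> x - \<psi> y\<bar> \<le> L * N (x - y)" and L: "0 \<le> L"
    and g: "dual_norm N g \<le> G"
    and y: "y \<in> X" and x': "x' \<in> X" and z: "z \<in> X"
    and sub: "\<phi> x + g \<bullet> (z - x) \<le> \<phi> z"
    and phi_lip: "\<phi> x' \<le> \<phi> x + G * N (x' - x)"
    and V: "N (y - x) \<le> V" "N (y - x') \<le> V" "N (x' - x) \<le> V"
  defines "h \<equiv> G + L + dual_norm N \<xi>"
  shows "a * (\<phi> x' + \<psi> x' - (\<phi> z + \<psi> z))
      \<le> bregman \<Phi> d\<Phi> z y - bregman \<Phi> d\<Phi> z p + a * (\<xi> \<bullet> (y - z)) + a\<^sup>2 * h\<^sup>2 / \<sigma> + a * (2 * G + L) * V"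
    and "N (p - y) \<le> a * h / \<sigma>"
proof -
  have sigma: "\<sigma> > 0" using breg by (simp add: bregman_assumption_def)
  have p: "p \<in> X" using arg by (simp add: is_arg_min_def)
  have diff: "(\<Phi> has_derivative (\<lambda>h. d\<Phi> p \<bullet> h)) (at p within X)"
    using breg p by (simp add: bregman_assumption_def)
  note D = is_norm_dual_norm[OF N]
  have G: "0 \<le> G" using g is_norm_nonneg[OF D, of g] by linarith
  define d where "d = N (p - y)"
  have "d \<le> a * (dual_norm N (g - \<xi>) + L) / \<sigma>"
    unfolding d_def by (rule mirror_step_displacement[OF N X psi a breg arg lip y L])
  also have "\<dots> \<le> a * h / \<sigma>"
    unfolding h_def using is_norm_triangle[OF D, of g "- \<xi>"] is_norm_minus[OF D, of \<xi>] g a sigma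
    by (intro divide_right_mono mult_left_mono) auto
  finally have d: "d \<le> a * h / \<sigma>" .
  then show "N (p - y) \<le> a * h / \<sigma>" by (simp add: d_def)
  have h: "0 \<le> h" unfolding h_def using G L is_norm_nonneg[OF D, of \<xi>] by linarith
  have opt: "a * ((g - \<xi>) \<bullet> (p - z) + \<psi> p - \<psi> z) \<le> bregman \<Phi> d\<Phi> z y - bregman \<Phi> d\<Phi> z p"
    using mirror_step_optimality[OF X psi a diff arg z] bregman_nonneg[OF breg p y] by linarith
  have g_px: "- (G * (d + V)) \<le> g \<bullet> (p - x)"
  proof -
    have "dual_norm N g * N (p - x) \<le> G * (d + V)"
      using is_norm_triangle_via[OF N, of p x y] V(1) g G is_norm_nonneg[OF N, of "p - x"]
      unfolding d_def by (intro mult_mono) auto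
    then show ?thesis using abs_inner_le_dual_norm[OF N, of g "p - x"] by linarith
  qed
  have phi_x: "\<phi> x' - G * V \<le> \<phi> x"
    using phi_lip mult_left_mono[OF V(3) G] by linarith
  have psi_p: "\<psi> x' - L * (d + V) \<le> \<psi> p"
  proof -
    have "L * N (p - x') \<le> L * (d + V)"
      using is_norm_triangle_via[OF N, of p x' y] V(2) L unfolding d_def by (intro mult_left_mono) auto
    then show ?thesis using lip[OF p x'] by linarith
  qed
  have xi_p: "\<xi> \<bullet> (p - z) \<le> \<xi> \<bullet> (y - z) + dual_norm N \<xi> * d"
  proof -
    have "\<xi> \<bullet> (p - z) = \<xi> \<bullet> (y - z) + \<xi> \<bullet> (p - y)" by (simp add: inner_diff_right)
    then show ?thesis using abs_inner_le_dual_norm[OF N, of \<xi> "p - y"] unfolding d_def by linarith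
  qed
  have "g \<bullet> (p - z) = g \<bullet> (p - x) - g \<bullet> (z - x)" by (simp add: inner_diff_right)
  then have "\<phi> x' + \<psi> x' - (\<phi> z + \<psi> z)
      \<le> ((g - \<xi>) \<bullet> (p - z) + \<psi> p - \<psi> z) + \<xi> \<bullet> (y - z) + h * d + (2 * G + L) * V"
    using g_px phi_x psi_p xi_p sub by (simp add: inner_diff_left h_def algebra_simps)
  from mult_left_mono[OF this, of a] a
  have "a * (\<phi> x' + \<psi> x' - (\<phi> z + \<psi> z))
      \<le> a * ((g - \<xi>) \<bullet> (p - z) + \<psi> p - \<psi> z) + a * (\<xi> \<bullet> (y - z)) + a * (h * d) + a * (2 * G + L) * V"
    by (simp add: algebra_simps)
  moreover have "a * (h * d) \<le> a * (h * (a * h / \<sigma>))" using a h d by (intro mult_left_mono) auto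
  moreover have "a * (h * (a * h / \<sigma>)) = a\<^sup>2 * h\<^sup>2 / \<sigma>" by (simp add: power2_eq_square)
  ultimately show "a * (\<phi> x' + \<psi> x' - (\<phi> z + \<psi> z))
      \<le> bregman \<Phi> d\<Phi> z y - bregman \<Phi> d\<Phi> z p + a * (\<xi> \<bullet> (y - z)) + a\<^sup>2 * h\<^sup>2 / \<sigma> + a * (2 * G + L) * V"
    using opt by linarith
qed

locale dcsmd_problem =
  fixes X S :: "(real ^ 'n) set"
    and N :: "real ^ 'n \<Rightarrow> real"
    and f \<psi> :: "'m::finite \<Rightarrow> real ^ 'n \<Rightarrow> real"
    and \<Phi> :: "real ^ 'n \<Rightarrow> real"
    and d\<Phi> :: "real ^ 'n \<Rightarrow> real ^ 'n"
    and xstar :: "real ^ 'n"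
    and W :: "nat \<Rightarrow> real ^ 'm ^ 'm"
    and B :: nat
    and \<eta> \<sigma> G G\<psi> :: real
  assumes norm: "is_norm N"
    and X_convex: "convex X" and X_sub_S: "X \<subseteq> S"
    and f_convex: "\<And>i. convex_on S (f i)" and psi_convex: "\<And>i. convex_on X (\<psi> i)"
    and xstar: "xstar \<in> X"
    and minimal: "\<And>z. z \<in> X \<Longrightarrow> (\<Sum>i\<in>UNIV. f i xstar + \<psi> i xstar) \<le> (\<Sum>i\<in>UNIV. f i z + \<psi> i z)"
    and network: "network_assumption W B \<eta>"
    and bounded: "bounded_assumption X S N f \<psi> G G\<psi>"
    and bregman: "bregman_assumption TYPE('m) X N \<Phi> d\<Phi> \<sigma>"
begin

abbreviation gap :: "real ^ 'n \<Rightarrow> real" where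
  "gap z \<equiv> (\<Sum>i\<in>UNIV. f i z + \<psi> i z) - (\<Sum>i\<in>UNIV. f i xstar + \<psi> i xstar)"

lemma gap_nonneg: "z \<in> X \<Longrightarrow> 0 \<le> gap z"
  using minimal[of z] by simp

lemma subgradient_bound: "x \<in> X \<Longrightarrow> g \<in> subdifferential S (f i) x \<Longrightarrow> dual_norm N g \<le> G"
  using bounded unfolding bounded_assumption_def by blast

lemma psi_lipschitz: "x \<in> X \<Longrightarrow> y \<in> X \<Longrightarrow> \<bar>\<psi> i x - \<psi> i y\<bar> \<le> G\<psi> * N (x - y)"
  using bounded unfolding bounded_assumption_def by blast

lemma sigma_pos: "0 < \<sigma>" and G_pos: "0 < G" and Gpsi_pos: "0 < G\<psi>"
  using bregman bounded by (auto simp: bregman_assumption_def bounded_assumption_def)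

lemma S_convex: "convex S"
  using f_convex by (rule convex_on_imp_convex)

lemma subgradient_imp_interior:
  assumes "x \<in> X" "g \<in> subdifferential S (f i) x"
  shows "x \<in> interior S"
proof (rule bounded_subdifferential_imp_interior[OF norm S_convex _ assms(2)])
  show "x \<in> S" using assms(1) X_sub_S by blast
qed (rule subgradient_bound[OF assms(1)])

text \<open>
  A subgradient at \<open>x\<close> bounds \<open>f i x\<close> from above in terms of the value at any other point; it exists because \<open>x\<close>
  is interior.
\<close>

lemma f_upper_bound:
  assumes "x \<in> X" "x \<in> interior S" "y \<in> S"
  shows "f i x \<le> f i y + G * N (x - y)"
proof -
  obtain g where g: "g \<in> subdifferential S (f i) x"
    using subgradient_exists_interior[OF f_convex assms(2)] by blast
  then have "f i x + g \<bullet> (y - x) \<le> f i y" using assms(3) by (simp add: subdifferential_def)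
  moreover have "\<bar>g \<bullet> (y - x)\<bar> \<le> dual_norm N g * N (y - x)" by (rule abs_inner_le_dual_norm[OF norm])
  moreover have "dual_norm N g * N (y - x) \<le> G * N (x - y)"
    using subgradient_bound[OF assms(1) g] is_norm_nonneg[OF norm] is_norm_minus_commute[OF norm, of y x]
    by (simp add: mult_right_mono)
  ultimately show ?thesis by linarith
qed

lemma weights:
  assumes "t \<ge> 1"
  shows "0 \<le> W t $ i $ j" "(\<Sum>j\<in>UNIV. W t $ i $ j) = 1" "(\<Sum>i\<in>UNIV. W t $ i $ j) = 1"
  using network_doubly_stochastic[OF network assms] by (auto simp: doubly_stochastic_def)

end

text \<open>
  One realization of the run up to the horizon \<open>T\<close>, with all randomness fixed.  Everything about the algorithm that
  does not involve probabilities is a statement about such a trajectory.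
\<close>

locale dcsmd_path = dcsmd_problem X S N f \<psi> \<Phi> d\<Phi> xstar W B \<eta> \<sigma> G G\<psi>
  for X S :: "(real ^ 'n) set"
    and N :: "real ^ 'n \<Rightarrow> real"
    and f \<psi> :: "'m::finite \<Rightarrow> real ^ 'n \<Rightarrow> real"
    and \<Phi> :: "real ^ 'n \<Rightarrow> real"
    and d\<Phi> :: "real ^ 'n \<Rightarrow> real ^ 'n"
    and xstar :: "real ^ 'n"
    and W :: "nat \<Rightarrow> real ^ 'm ^ 'm"
    and B :: nat
    and \<eta> \<sigma> G G\<psi> :: real +
  fixes a :: real and T :: nat
    and x y g \<xi> :: "'m \<Rightarrow> nat \<Rightarrow> real ^ 'n"
  assumes a: "0 < a"
    and start: "\<And>i. x i 1 \<in> X"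
    and y_def: "\<And>i t. y i t = (\<Sum>j\<in>UNIV. W t $ i $ j *\<^sub>R x j t)"
    and subgradient: "\<And>i t. t \<in> {1..T} \<Longrightarrow> g i t \<in> subdifferential S (f i) (x i t)"
    and step: "\<And>i t. t \<in> {1..T} \<Longrightarrow>
      is_arg_min (\<lambda>z. (g i t - \<xi> i t) \<bullet> z + 1 / a * bregman \<Phi> d\<Phi> z (y i t) + \<psi> i z)
        (\<lambda>z. z \<in> X) (x i (Suc t))"
begin

definition energy :: "nat \<Rightarrow> real" where
  "energy t = (\<Sum>i\<in>UNIV. bregman \<Phi> d\<Phi> xstar (x i t))"

definition noise_level :: "'m \<Rightarrow> nat \<Rightarrow> real" where
  "noise_level i t = G + G\<psi> + dual_norm N (\<xi> i t)"

lemma x_in_X: "t \<in> {1..Suc T} \<Longrightarrow> x i t \<in> X"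
proof (cases "t = 1")
  case False
  assume "t \<in> {1..Suc T}"
  with False obtain s where s: "t = Suc s" "s \<in> {1..T}" by (cases t) auto
  show ?thesis using step[OF s(2), of i] by (simp add: s(1) is_arg_min_def)
qed (use start in simp)

lemma y_in_X: "t \<in> {1..Suc T} \<Longrightarrow> y i t \<in> X"
  unfolding y_def by (intro convex_sum X_convex weights x_in_X) auto

lemma x_interior: "t \<in> {1..T} \<Longrightarrow> x i t \<in> interior S"
  using subgradient_imp_interior[OF x_in_X subgradient] by simp

lemma bregman_mixed_sum_le:
  assumes "t \<in> {1..Suc T}"
  shows "(\<Sum>i\<in>UNIV. bregman \<Phi> d\<Phi> xstar (y i t)) \<le> energy t"
proof -
  have t: "t \<ge> 1" using assms by simp
  have "bregman \<Phi> d\<Phi> xstar (y i t) \<le> (\<Sum>j\<in>UNIV. W t $ i $ j * bregman \<Phi> d\<Phi> xstar (x j t))" for i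
    unfolding y_def
    by (rule bregman_convex_combination[OF bregman xstar, where y = "\<lambda>j. x j t"])
      (use x_in_X[OF assms] weights[OF t] in auto)
  then have "(\<Sum>i\<in>UNIV. bregman \<Phi> d\<Phi> xstar (y i t))
      \<le> (\<Sum>i\<in>UNIV. \<Sum>j\<in>UNIV. W t $ i $ j * bregman \<Phi> d\<Phi> xstar (x j t))"
    by (rule sum_mono)
  also have "\<dots> = (\<Sum>j\<in>UNIV. (\<Sum>i\<in>UNIV. W t $ i $ j) * bregman \<Phi> d\<Phi> xstar (x j t))"
    unfolding sum_distrib_right by (rule sum.swap)
  also have "\<dots> = energy t" by (simp add: weights[OF t] energy_def)
  finally show ?thesis .
qed

lemma mixed_distance_le_energy:
  assumes "t \<in> {1..Suc T}"
  shows "\<sigma> / 2 * (N (y i t - xstar))\<^sup>2 \<le> energy t"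
proof -
  have "\<sigma> / 2 * (N (y i t - xstar))\<^sup>2 \<le> bregman \<Phi> d\<Phi> xstar (y i t)"
    using bregman_lower_bound[OF bregman xstar y_in_X[OF assms]] is_norm_minus_commute[OF norm] by simp
  also have "\<dots> \<le> (\<Sum>i\<in>UNIV. bregman \<Phi> d\<Phi> xstar (y i t))"
    by (rule member_le_sum) (auto intro: bregman_nonneg[OF bregman xstar y_in_X[OF assms]])
  also have "\<dots> \<le> energy t" by (rule bregman_mixed_sum_le[OF assms])
  finally show ?thesis .
qed

lemma agent_progress:
  assumes t: "t \<in> {1..T}"
  shows "a * (f i (x l t) + \<psi> i (x l t) - (f i xstar + \<psi> i xstar))
      \<le> bregman \<Phi> d\<Phi> xstar (y i t) - bregman \<Phi> d\<Phi> xstar (x i (Suc t)) + a * (\<xi> i t \<bullet> (y i t - xstar))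
        + a\<^sup>2 * (noise_level i t)\<^sup>2 / \<sigma> + a * (2 * G + G\<psi>) * spread N (\<lambda>i. x i t)"
    and "N (x i (Suc t) - y i t) \<le> a * noise_level i t / \<sigma>"
proof -
  have t': "t \<in> {1..Suc T}" "t \<ge> 1" using t by auto
  have y_near: "N (y i t - x k t) \<le> spread N (\<lambda>i. x i t)" for k
    unfolding y_def
    by (rule is_norm_convex_combination_diff_le[OF norm, where z = "\<lambda>i. x i t"]) (simp_all add: weights[OF t'(2)])
  have sub: "f i (x i t) + g i t \<bullet> (xstar - x i t) \<le> f i xstar"
    using subgradient[OF t, of i] xstar X_sub_S by (auto simp: subdifferential_def)
  have lip: "f i (x l t) \<le> f i (x i t) + G * N (x l t - x i t)"
    using x_in_X[OF t'(1)] x_interior[OF t] X_sub_S by (intro f_upper_bound) auto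
  have Gpsi: "0 \<le> G\<psi>" using Gpsi_pos by simp
  note progress = mirror_step_progress[OF norm X_convex psi_convex a bregman step[OF t, of i],
      where L = G\<psi> and G = G and x' = "x l t" and z = xstar and \<phi> = "f i" and x = "x i t"
        and V = "spread N (\<lambda>i. x i t)"]
  have g: "dual_norm N (g i t) \<le> G" by (rule subgradient_bound[OF x_in_X[OF t'(1)] subgradient[OF t]])
  note facts = psi_lipschitz Gpsi g y_in_X[OF t'(1)] x_in_X[OF t'(1)] xstar sub lip y_near
    le_spread[of N "\<lambda>i. x i t" l i]
  show "a * (f i (x l t) + \<psi> i (x l t) - (f i xstar + \<psi> i xstar))
      \<le> bregman \<Phi> d\<Phi> xstar (y i t) - bregman \<Phi> d\<Phi> xstar (x i (Suc t)) + a * (\<xi> i t \<bullet> (y i t - xstar))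
        + a\<^sup>2 * (noise_level i t)\<^sup>2 / \<sigma> + a * (2 * G + G\<psi>) * spread N (\<lambda>i. x i t)"
    unfolding noise_level_def by (rule progress(1); (rule facts)?; assumption?)
  show "N (x i (Suc t) - y i t) \<le> a * noise_level i t / \<sigma>"
    unfolding noise_level_def by (rule progress(2); (rule facts)?; assumption?)
qed

lemma energy_inequality:
  assumes "\<tau> \<le> T"
  shows "energy (Suc \<tau>) + a * (\<Sum>t=1..\<tau>. gap (x l t))
      \<le> energy 1 + a * (\<Sum>t=1..\<tau>. \<Sum>i\<in>UNIV. \<xi> i t \<bullet> (y i t - xstar))
        + (\<Sum>t=1..\<tau>. \<Sum>i\<in>UNIV. a\<^sup>2 * (noise_level i t)\<^sup>2 / \<sigma>)
        + a * (2 * G + G\<psi>) * real CARD('m) * (\<Sum>t=1..\<tau>. spread N (\<lambda>i. x i t))"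
  using assms
proof (induction \<tau>)
  case (Suc \<tau>)
  then have t: "Suc \<tau> \<in> {1..T}" "Suc \<tau> \<in> {1..Suc T}" by auto
  let ?t = "Suc \<tau>"
  have "a * gap (x l ?t) = (\<Sum>i\<in>UNIV. a * (f i (x l ?t) + \<psi> i (x l ?t) - (f i xstar + \<psi> i xstar)))"
    by (simp add: sum_subtractf flip: sum_distrib_left)
  also have "\<dots> \<le> (\<Sum>i\<in>UNIV. bregman \<Phi> d\<Phi> xstar (y i ?t) - bregman \<Phi> d\<Phi> xstar (x i (Suc ?t))
        + a * (\<xi> i ?t \<bullet> (y i ?t - xstar))
        + a\<^sup>2 * (noise_level i ?t)\<^sup>2 / \<sigma> + a * (2 * G + G\<psi>) * spread N (\<lambda>i. x i ?t))"
    by (intro sum_mono agent_progress(1) t)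
  also have "\<dots> = (\<Sum>i\<in>UNIV. bregman \<Phi> d\<Phi> xstar (y i ?t)) - energy (Suc ?t)
        + a * (\<Sum>i\<in>UNIV. \<xi> i ?t \<bullet> (y i ?t - xstar)) + (\<Sum>i\<in>UNIV. a\<^sup>2 * (noise_level i ?t)\<^sup>2 / \<sigma>)
        + a * (2 * G + G\<psi>) * real CARD('m) * spread N (\<lambda>i. x i ?t)"
    by (simp add: sum.distrib sum_subtractf energy_def sum_distrib_left)
  finally have "energy (Suc ?t) + a * gap (x l ?t) \<le> energy ?t
        + a * (\<Sum>i\<in>UNIV. \<xi> i ?t \<bullet> (y i ?t - xstar)) + (\<Sum>i\<in>UNIV. a\<^sup>2 * (noise_level i ?t)\<^sup>2 / \<sigma>)
        + a * (2 * G + G\<psi>) * real CARD('m) * spread N (\<lambda>i. x i ?t)"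
    using bregman_mixed_sum_le[OF t(2)] by linarith
  then show ?case using Suc by (simp add: distrib_left)
qed simp

text \<open>
  With \<open>a\<^sup>2 * T \<le> 1\<close> the squared noise terms form an average over time, and the disagreement, multiplied by \<open>a\<close>, is
  again \<open>a\<^sup>2\<close> times a sum of noise levels.  So the total error does not grow with the horizon.
\<close>

lemma energy_inequality_of_noise_bound:
  assumes consensus: "\<And>(z :: nat \<Rightarrow> 'm \<Rightarrow> real ^ 'n) e T.
       (\<And>t i. t \<ge> 1 \<Longrightarrow> N (z (Suc t) i - (\<Sum>j\<in>UNIV. W t $ i $ j *\<^sub>R z t j)) \<le> e t) \<Longrightarrow>
       (\<Sum>t=1..T. spread N (z t)) \<le> c * (spread N (z 1) + (\<Sum>t=1..T. e t))" and c: "0 \<le> c"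
    and h: "\<And>i t. t \<in> {1..T} \<Longrightarrow> noise_level i t \<le> h" "0 \<le> h"
    and aT: "a\<^sup>2 * real T \<le> 1" "a \<le> 1"
    and tau: "\<tau> \<le> T"
  shows "energy (Suc \<tau>) + a * (\<Sum>t=1..\<tau>. gap (x l t))
      \<le> energy 1 + a * (\<Sum>t=1..\<tau>. \<Sum>i\<in>UNIV. \<xi> i t \<bullet> (y i t - xstar))
        + (real CARD('m) * h\<^sup>2 / \<sigma>
           + (2 * G + G\<psi>) * real CARD('m) * c * (spread N (\<lambda>i. x i 1) + real CARD('m) * h / \<sigma>))"
proof -
  let ?m = "real CARD('m)"
  note sigma = sigma_pos
  have level_nonneg: "0 \<le> noise_level i t" for i t
    using G_pos Gpsi_pos is_norm_nonneg[OF is_norm_dual_norm[OF norm], of "\<xi> i t"] by (simp add: noise_level_def)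
  have tau_T: "a\<^sup>2 * real \<tau> \<le> 1"
    using tau aT(1) mult_left_mono[of "real \<tau>" "real T" "a\<^sup>2"] by simp
  have "(\<Sum>t=1..\<tau>. \<Sum>i\<in>UNIV. a\<^sup>2 * (noise_level i t)\<^sup>2 / \<sigma>) \<le> (\<Sum>t=1..\<tau>. \<Sum>i\<in>(UNIV :: 'm set). a\<^sup>2 * h\<^sup>2 / \<sigma>)"
    using tau sigma level_nonneg h by (intro sum_mono divide_right_mono mult_left_mono power_mono) auto
  also have "\<dots> = (a\<^sup>2 * real \<tau>) * (?m * h\<^sup>2 / \<sigma>)" by simp
  also have "\<dots> \<le> 1 * (?m * h\<^sup>2 / \<sigma>)" using tau_T sigma by (intro mult_right_mono) auto
  finally have quad: "(\<Sum>t=1..\<tau>. \<Sum>i\<in>UNIV. a\<^sup>2 * (noise_level i t)\<^sup>2 / \<sigma>) \<le> ?m * h\<^sup>2 / \<sigma>" by simp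

  let ?e = "\<lambda>t. \<Sum>i\<in>UNIV. N (x i (Suc t) - y i t)"
  have "(\<Sum>t=1..\<tau>. spread N (\<lambda>i. x i t)) \<le> c * (spread N (\<lambda>i. x i 1) + (\<Sum>t=1..\<tau>. ?e t))"
  proof (rule consensus[of "\<lambda>t i. x i t"])
    fix t i
    have "N (x i (Suc t) - y i t) \<le> ?e t"
      by (rule member_le_sum) (auto intro: is_norm_nonneg[OF norm])
    then show "N (x i (Suc t) - (\<Sum>j\<in>UNIV. W t $ i $ j *\<^sub>R x j t)) \<le> ?e t" by (simp add: y_def)
  qed
  then have "a * (\<Sum>t=1..\<tau>. spread N (\<lambda>i. x i t)) \<le> a * (c * (spread N (\<lambda>i. x i 1) + (\<Sum>t=1..\<tau>. ?e t)))"
    using a by (intro mult_left_mono) auto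
  also have "\<dots> = c * (a * spread N (\<lambda>i. x i 1) + a * (\<Sum>t=1..\<tau>. ?e t))" by (simp add: algebra_simps)
  also have "\<dots> \<le> c * (spread N (\<lambda>i. x i 1) + ?m * h / \<sigma>)"
  proof (intro mult_left_mono add_mono c)
    show "a * spread N (\<lambda>i. x i 1) \<le> spread N (\<lambda>i. x i 1)"
      using aT(2) a spread_nonneg[OF norm, of "\<lambda>i. x i 1"] by (simp add: mult_left_le_one_le)
    have "(\<Sum>t=1..\<tau>. ?e t) \<le> (\<Sum>t=1..\<tau>. \<Sum>i\<in>(UNIV :: 'm set). a * h / \<sigma>)"
    proof (intro sum_mono)
      fix t i assume "t \<in> {1..\<tau>}"
      then have t: "t \<in> {1..T}" using tau by simp
      have "a * noise_level i t / \<sigma> \<le> a * h / \<sigma>"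
        using h(1)[OF t] a sigma by (intro divide_right_mono mult_left_mono) auto
      then show "N (x i (Suc t) - y i t) \<le> a * h / \<sigma>" using agent_progress(2)[OF t, of i] by linarith
    qed
    then have "a * (\<Sum>t=1..\<tau>. ?e t) \<le> a * (\<Sum>t=1..\<tau>. \<Sum>i\<in>(UNIV :: 'm set). a * h / \<sigma>)"
      using a by (intro mult_left_mono) auto
    also have "\<dots> = (a\<^sup>2 * real \<tau>) * (?m * h / \<sigma>)" by (simp add: power2_eq_square)
    also have "\<dots> \<le> 1 * (?m * h / \<sigma>)" using tau_T sigma h(2) by (intro mult_right_mono) auto
    finally show "a * (\<Sum>t=1..\<tau>. ?e t) \<le> ?m * h / \<sigma>" by simp
  qed
  finally have "(2 * G + G\<psi>) * ?m * (a * (\<Sum>t=1..\<tau>. spread N (\<lambda>i. x i t)))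
      \<le> (2 * G + G\<psi>) * ?m * (c * (spread N (\<lambda>i. x i 1) + ?m * h / \<sigma>))"
    using G_pos Gpsi_pos by (intro mult_left_mono) auto
  moreover have "a * (2 * G + G\<psi>) * ?m * (\<Sum>t=1..\<tau>. spread N (\<lambda>i. x i t))
      = (2 * G + G\<psi>) * ?m * (a * (\<Sum>t=1..\<tau>. spread N (\<lambda>i. x i t)))" by (simp only: mult_ac)
  moreover have "(2 * G + G\<psi>) * ?m * (c * (spread N (\<lambda>i. x i 1) + ?m * h / \<sigma>))
      = (2 * G + G\<psi>) * ?m * c * (spread N (\<lambda>i. x i 1) + ?m * h / \<sigma>)" by (simp only: mult.assoc)
  ultimately show ?thesis using energy_inequality[OF tau, of l] quad by linarith
qed

text \<open>
  The stochastic terms are only controlled as long as the mixed points stay within distance \<open>r\<close> of the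
  minimizer.  Before the first exit time the stopped sum is the sum itself, and then the energy
  inequality keeps the energy below \<open>K\<^sup>2\<close>, hence the mixed points within distance \<open>r\<close>: there is no exit.
\<close>

lemma stopped_noise_bound_imp_no_exit:
  assumes energy: "\<And>\<tau>. \<tau> \<le> T \<Longrightarrow> energy (Suc \<tau>) + a * (\<Sum>t=1..\<tau>. gap (x l t))
      \<le> energy 1 + a * (\<Sum>t=1..\<tau>. \<Sum>i\<in>UNIV. \<xi> i t \<bullet> (y i t - xstar)) + R"
    and stays: "\<And>t. stays t \<longleftrightarrow> (\<forall>s\<in>{1..t}. \<forall>j. N (y j s - xstar) \<le> r)"
    and r: "\<sigma> / 2 * r\<^sup>2 = K\<^sup>2" "0 \<le> r"
    and stopped: "a * (\<Sum>t=1..T. \<Sum>i\<in>UNIV. if stays t then \<xi> i t \<bullet> (y i t - xstar) else 0) \<le> Q"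
    and budget: "energy 1 + R + Q \<le> K\<^sup>2"
  shows "a * (\<Sum>t=1..T. gap (x l t)) \<le> K\<^sup>2"
proof -
  let ?s = "\<lambda>t. \<Sum>i\<in>UNIV. \<xi> i t \<bullet> (y i t - xstar)"
  have stopped': "a * (\<Sum>t=1..T. if stays t then ?s t else 0) \<le> Q"
  proof -
    have "(\<Sum>i\<in>UNIV. if stays t then \<xi> i t \<bullet> (y i t - xstar) else 0) = (if stays t then ?s t else 0)" for t
      by simp
    then show ?thesis using stopped by simp
  qed
  have bound: "energy (Suc \<tau>) + a * (\<Sum>t=1..\<tau>. gap (x l t)) \<le> K\<^sup>2"
    if tau: "\<tau> \<le> T" "stays \<tau>" "\<tau> = T \<or> \<not> stays (Suc \<tau>)" for \<tau>
  proof -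
    have eq: "(\<Sum>t=1..T. if stays t then ?s t else 0) = (\<Sum>t=1..\<tau>. ?s t)"
    proof (rule sum.mono_neutral_cong_right)
      show "\<forall>t\<in>{1..T} - {1..\<tau>}. (if stays t then ?s t else 0) = 0"
      proof
        fix t assume t: "t \<in> {1..T} - {1..\<tau>}"
        then have "\<not> stays (Suc \<tau>)" "Suc \<tau> \<le> t" using tau(3) by auto
        then have "\<not> stays t" unfolding stays by (meson atLeastAtMost_iff order_trans)
        then show "(if stays t then ?s t else 0) = 0" by simp
      qed
      show "(if stays t then ?s t else 0) = ?s t" if "t \<in> {1..\<tau>}" for t
        using that tau(2) by (auto simp: stays)
    qed (use tau(1) in auto)
    show ?thesis using stopped'[unfolded eq] energy[OF tau(1)] budget by linarith
  qed
  have gaps: "0 \<le> a * (\<Sum>t=1..\<tau>. gap (x l t))" if "\<tau> \<le> T" for \<tau>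
    using a that by (intro mult_nonneg_nonneg sum_nonneg gap_nonneg x_in_X) auto
  have "stays \<tau>" if "\<tau> \<le> T" for \<tau>
    using that
  proof (induction \<tau>)
    case 0
    then show ?case by (simp add: stays)
  next
    case (Suc \<tau>)
    show ?case
    proof (rule ccontr)
      assume exit: "\<not> stays (Suc \<tau>)"
      have ins: "stays \<tau>" using Suc by simp
      have "energy (Suc \<tau>) \<le> K\<^sup>2" using bound[of \<tau>] exit ins gaps[of \<tau>] Suc.prems by simp
      then have "\<sigma> / 2 * (N (y j (Suc \<tau>) - xstar))\<^sup>2 \<le> \<sigma> / 2 * r\<^sup>2" for j
        using mixed_distance_le_energy[of "Suc \<tau>" j] Suc.prems r(1) by simp
      then have "(N (y j (Suc \<tau>) - xstar))\<^sup>2 \<le> r\<^sup>2" for j using sigma_pos by simp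
      then have "N (y j (Suc \<tau>) - xstar) \<le> r" for j using r(2) power2_le_imp_le by blast
      with ins have "stays (Suc \<tau>)" unfolding stays by (auto simp: le_Suc_eq)
      with exit show False by blast
    qed
  qed
  then have "energy (Suc T) + a * (\<Sum>t=1..T. gap (x l t)) \<le> K\<^sup>2" using bound[of T] by simp
  moreover have "0 \<le> energy (Suc T)"
    unfolding energy_def using x_in_X[of "Suc T"] by (intro sum_nonneg bregman_nonneg[OF bregman xstar]) simp
  ultimately show ?thesis by linarith
qed

end

section \<open>The bound with high probability\<close>

text \<open>
  \<open>b\<close> is the level that no noise norm (in units of \<open>\<kappa>\<close>) exceeds, \<open>R\<close> bounds the deterministic part of the energy
  balance, and \<open>J * K\<close> bounds the stochastic part while the energy is at most \<open>K\<^sup>2\<close>.  The value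
  \<open>K = J + sqrt (A + R)\<close> satisfies \<open>A + R + J * K \<le> K\<^sup>2\<close>, so the energy is confined.
\<close>

definition energy_radius ::
  "real \<Rightarrow> real \<Rightarrow> real \<Rightarrow> real \<Rightarrow> real \<Rightarrow> real \<Rightarrow> real \<Rightarrow> real \<Rightarrow> real \<Rightarrow> real \<Rightarrow> real \<Rightarrow> real \<Rightarrow> real" where
  "energy_radius m A s c C G\<^sub>1 G\<^sub>2 \<kappa> \<sigma> \<theta> T \<delta> =
     (let b = ln (4 * m * T / \<delta>) powr \<theta>;
          \<Lambda> = max 1 (b powr (1 - 1 / \<theta>));
          h = G\<^sub>1 + \<kappa> * b;
          R = m * h\<^sup>2 / \<sigma> + G\<^sub>2 * m * c * (s + m * h / \<sigma>);
          J = 2 * \<Lambda> * \<kappa> * sqrt (2 / \<sigma>) * m * (2 * C + ln (2 * m / \<delta>))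
      in J + sqrt (A + R))"

context dcsmd_problem
begin

text \<open>
  Continuity can fail on the part of \<open>X\<close> that lies on the boundary of \<open>S\<close>; it is needed only for the measurability of
  the final event, and averages of iterates never leave \<open>interior S\<close>.
\<close>

lemma continuous_on_gap: "continuous_on (X \<inter> interior S) gap"
proof -
  have "continuous_on (X \<inter> interior S) (f i)" for i
  proof (rule continuous_on_subset)
    show "continuous_on (interior S) (f i)"
      by (rule convex_on_continuous[OF open_interior])
        (rule convex_on_subset[OF f_convex interior_subset convex_interior[OF S_convex]])
  qed simp
  moreover have "continuous_on (X \<inter> interior S) (\<psi> i)" for i
  proof (rule continuous_on_subset)
    define L where "L = G\<psi> * (\<Sum>k\<in>UNIV. N (axis k 1))"
    have "L-lipschitz_on X (\<psi> i)"
    proof (rule lipschitz_onI)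
      fix x y assume xy: "x \<in> X" "y \<in> X"
      have "\<bar>\<psi> i x - \<psi> i y\<bar> \<le> G\<psi> * N (x - y)" by (rule psi_lipschitz[OF xy])
      also have "\<dots> \<le> G\<psi> * ((\<Sum>k\<in>UNIV. N (axis k 1)) * norm (x - y))"
        using Gpsi_pos by (intro mult_left_mono is_norm_le_norm[OF norm]) auto
      finally show "dist (\<psi> i x) (\<psi> i y) \<le> L * dist x y"
        by (simp add: dist_norm L_def mult.assoc)
    next
      show "0 \<le> L"
        unfolding L_def using Gpsi_pos
        by (intro mult_nonneg_nonneg sum_nonneg is_norm_nonneg[OF norm]) auto
    qed
    then show "continuous_on X (\<psi> i)" by (rule lipschitz_on_continuous_on)
  qed simp
  ultimately show ?thesis by (intro continuous_intros)
qed

lemma gap_average_le: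
  assumes T: "T \<ge> 1" and x: "\<And>t. t \<in> {1..T} \<Longrightarrow> x t \<in> X"
  shows "gap ((1 / real T) *\<^sub>R (\<Sum>t=1..T. x t)) \<le> (1 / real T) * (\<Sum>t=1..T. gap (x t))"
proof -
  have avg: "(1 / real T) *\<^sub>R (\<Sum>t=1..T. x t) = (\<Sum>t=1..T. (1 / real T) *\<^sub>R x t)"
    by (rule scaleR_right.sum)
  have jensen: "h (\<Sum>t=1..T. (1 / real T) *\<^sub>R x t) \<le> (\<Sum>t=1..T. (1 / real T) * h (x t))" if "convex_on X h" for h
    using T x that by (intro convex_on_sum[of _ X h]) auto
  have "(\<Sum>i\<in>UNIV. f i (\<Sum>t=1..T. (1 / real T) *\<^sub>R x t) + \<psi> i (\<Sum>t=1..T. (1 / real T) *\<^sub>R x t))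
      \<le> (\<Sum>i\<in>UNIV. (\<Sum>t=1..T. (1 / real T) * f i (x t)) + (\<Sum>t=1..T. (1 / real T) * \<psi> i (x t)))"
    by (intro sum_mono add_mono jensen psi_convex convex_on_subset[OF f_convex X_sub_S X_convex])
  also have "\<dots> = (\<Sum>t=1..T. (1 / real T) * (\<Sum>i\<in>UNIV. f i (x t) + \<psi> i (x t)))"
    by (simp only: sum.distrib sum_distrib_left distrib_left sum.swap[of _ "{1..T}" UNIV])
  finally have "gap (\<Sum>t=1..T. (1 / real T) *\<^sub>R x t)
      \<le> (\<Sum>t=1..T. (1 / real T) * (\<Sum>i\<in>UNIV. f i (x t) + \<psi> i (x t))) - (\<Sum>i\<in>UNIV. f i xstar + \<psi> i xstar)"
    by simp
  also have "\<dots> = (1 / real T) * (\<Sum>t=1..T. gap (x t))"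
    using T by (simp add: sum_subtractf right_diff_distrib flip: sum_distrib_left sum_divide_distrib)
  finally show ?thesis unfolding avg .
qed

text \<open>
  The failure probability \<open>\<delta>\<close> is divided equally: one half pays for noise norms above the level \<open>b\<close>, \<open>\<delta> / (2 * m * T)\<close> for each agent
  and step, and the other half for large stopped noise sums, \<open>\<delta> / (2 * m)\<close> for each agent.  The factor \<open>1 / q\<close> scales the
  noise terms so that \<open>truncated_exp_le\<close> applies with \<open>\<beta> = a = 1 / sqrt T\<close>; then the product of \<open>T\<close> moment bounds stays
  below \<open>exp (2 * C)\<close>.
\<close>

lemma high_probability_bound:
  fixes M :: "'w measure" and x1 :: "'m \<Rightarrow> real ^ 'n" and x g \<xi> :: "'m \<Rightarrow> nat \<Rightarrow> 'w \<Rightarrow> real ^ 'n"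
  assumes x1: "\<And>i. x1 i \<in> X"
    and T: "T \<ge> 1" and alpha: "\<And>t. t \<in> {1..T} \<Longrightarrow> \<alpha> t = 1 / sqrt (real T)"
    and run: "dcsmd_sw_run X S f \<psi> \<Phi> d\<Phi> W x1 \<alpha> M Fil x g \<xi>"
    and noise: "noise_assumption M Fil N \<xi> \<theta> \<kappa>"
    and theta: "1 / 2 \<le> \<theta>" and kappa: "0 < \<kappa>" and delta: "0 < \<delta>" "\<delta> < 1"
    and consensus: "\<And>(z :: nat \<Rightarrow> 'm \<Rightarrow> real ^ 'n) e T.
       (\<And>t i. t \<ge> 1 \<Longrightarrow> N (z (Suc t) i - (\<Sum>j\<in>UNIV. W t $ i $ j *\<^sub>R z t j)) \<le> e t) \<Longrightarrow>
       (\<Sum>t=1..T. spread N (z t)) \<le> c * (spread N (z 1) + (\<Sum>t=1..T. e t))" and c: "0 \<le> c"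
    and C: "0 \<le> C" and trunc: "\<And>w b \<Lambda> \<beta> u.
        \<lbrakk>0 \<le> w; 0 \<le> b; 1 \<le> \<Lambda>; 1 \<le> \<theta> \<Longrightarrow> b powr (1 - 1 / \<theta>) \<le> \<Lambda>; 0 \<le> \<beta>; \<beta> \<le> 1; \<bar>u\<bar> \<le> \<beta> / (2 * \<Lambda>) * w\<rbrakk>
       \<Longrightarrow> (if w \<le> b then exp u else 0) \<le> 1 + u + C * \<beta>\<^sup>2 * exp (w powr (1 / \<theta>))"
    and L: "(energy_radius (real CARD('m)) (\<Sum>i\<in>UNIV. bregman \<Phi> d\<Phi> xstar (x1 i)) (spread N x1) c C
        (G + G\<psi>) (2 * G + G\<psi>) \<kappa> \<sigma> \<theta> (real T) \<delta>)\<^sup>2 \<le> L"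
  shows "1 - \<delta> \<le> measure M {\<omega> \<in> space M. gap ((1 / real T) *\<^sub>R (\<Sum>t=1..T. x l t \<omega>)) \<le> L * (1 / sqrt (real T))}"
proof -
  define m where "m = real CARD('m)"
  define b where "b = ln (4 * m * real T / \<delta>) powr \<theta>"
  define \<Lambda> where "\<Lambda> = max 1 (b powr (1 - 1 / \<theta>))"
  define h where "h = G + G\<psi> + \<kappa> * b"
  define R where "R = m * h\<^sup>2 / \<sigma> + (2 * G + G\<psi>) * m * c * (spread N x1 + m * h / \<sigma>)"
  define J where "J = 2 * \<Lambda> * \<kappa> * sqrt (2 / \<sigma>) * m * (2 * C + ln (2 * m / \<delta>))"
  define K where "K = J + sqrt ((\<Sum>i\<in>UNIV. bregman \<Phi> d\<Phi> xstar (x1 i)) + R)"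
  have L: "K\<^sup>2 \<le> L"
    using L unfolding energy_radius_def Let_def m_def b_def \<Lambda>_def h_def R_def J_def K_def .
  define a where "a = 1 / sqrt (real T)"
  have a: "0 < a" "a \<le> 1" "a\<^sup>2 * real T = 1"
    using T by (auto simp: a_def power_divide real_le_rsqrt)
  have m: "1 \<le> m" by (simp add: m_def Suc_leI)
  have run': "prob_space M" "filtration (space M) Fil" "\<And>t. subalgebra M (Fil t)"
    "\<And>i t. t \<ge> 1 \<Longrightarrow> x i t \<in> borel_measurable (Fil (t - 1))"
    "\<And>i t. t \<ge> 1 \<Longrightarrow> \<xi> i t \<in> borel_measurable (Fil t)"
    "\<And>i t k. t \<ge> 1 \<Longrightarrow> AE \<omega> in M. real_cond_exp M (Fil (t - 1)) (\<lambda>\<omega>. \<xi> i t \<omega> $ k) \<omega> = 0"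
    "\<And>\<omega> i. \<omega> \<in> space M \<Longrightarrow> x i 1 \<omega> = x1 i"
    "\<And>\<omega> i t. \<omega> \<in> space M \<Longrightarrow> t \<ge> 1 \<Longrightarrow> g i t \<omega> \<in> subdifferential S (f i) (x i t \<omega>)"
    "\<And>\<omega> i t. \<omega> \<in> space M \<Longrightarrow> t \<ge> 1 \<Longrightarrow> is_arg_min
          (\<lambda>z. (g i t \<omega> - \<xi> i t \<omega>) \<bullet> z + 1 / \<alpha> t * bregman \<Phi> d\<Phi> z (mixed W x i t \<omega>) + \<psi> i z)
          (\<lambda>z. z \<in> X) (x i (t + 1) \<omega>)"
    using run unfolding dcsmd_sw_run_def by blast+
  interpret prob_space M by (rule run')
  have sub_Fil: "subalgebra (Fil t) (Fil s)" if "s \<le> t" for s t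
    using filtration.space_F[OF run'(2)] filtration.sets_F_mono[OF run'(2) that] by (simp add: subalgebra_def)
  note D = is_norm_dual_norm[OF norm]
  define y where "y = mixed W x"
  have path: "dcsmd_path X S N f \<psi> \<Phi> d\<Phi> xstar W B \<eta> \<sigma> G G\<psi> a T
      (\<lambda>i t. x i t \<omega>) (\<lambda>i t. y i t \<omega>) (\<lambda>i t. g i t \<omega>) (\<lambda>i t. \<xi> i t \<omega>)" if "\<omega> \<in> space M" for \<omega>
  proof unfold_locales
    show "0 < a" by (rule a)
    show "x i 1 \<omega> \<in> X" for i using run'(7)[OF that] x1 by simp
    show "y i t \<omega> = (\<Sum>j\<in>UNIV. W t $ i $ j *\<^sub>R x j t \<omega>)" for i t by (simp add: y_def mixed_def)
    show "g i t \<omega> \<in> subdifferential S (f i) (x i t \<omega>)" if "t \<in> {1..T}" for i t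
      using run'(8)[OF \<open>\<omega> \<in> space M\<close>] that by simp
    show "is_arg_min (\<lambda>z. (g i t \<omega> - \<xi> i t \<omega>) \<bullet> z + 1 / a * bregman \<Phi> d\<Phi> z (y i t \<omega>) + \<psi> i z)
        (\<lambda>z. z \<in> X) (x i (Suc t) \<omega>)" if "t \<in> {1..T}" for i t
      using run'(9)[OF \<open>\<omega> \<in> space M\<close>, of t i] that alpha[OF that] by (simp add: a_def y_def)
  qed
  define A1 where "A1 = (\<Sum>i\<in>UNIV. bregman \<Phi> d\<Phi> xstar (x1 i))"
  have A1: "0 \<le> A1" unfolding A1_def by (intro sum_nonneg bregman_nonneg[OF bregman xstar x1])
  have "1 * 1 \<le> m * real T" using m T by (intro mult_mono) auto
  then have "1 < 4 * m * real T / \<delta>" using delta by (simp add: field_simps)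
  then have ln_pos: "0 < ln (4 * m * real T / \<delta>)" by (rule ln_gt_zero)
  have "1 < 2 * m / \<delta>" using m delta by (simp add: field_simps)
  then have ln_pos': "0 < ln (2 * m / \<delta>)" by (rule ln_gt_zero)
  have b: "0 < b" "b powr (1 / \<theta>) = ln (4 * m * real T / \<delta>)"
    using ln_pos theta by (auto simp: b_def powr_powr)
  have Lam: "1 \<le> \<Lambda>" "b powr (1 - 1 / \<theta>) \<le> \<Lambda>" by (auto simp: \<Lambda>_def)
  have h: "0 \<le> h" unfolding h_def using G_pos Gpsi_pos kappa b(1) by (intro add_nonneg_nonneg) auto
  have R: "0 \<le> R"
    unfolding R_def using m h c sigma_pos G_pos Gpsi_pos spread_nonneg[OF norm, of x1]
    by (intro add_nonneg_nonneg mult_nonneg_nonneg divide_nonneg_pos) auto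
  have J: "0 < J"
    unfolding J_def using Lam(1) kappa sigma_pos m C ln_pos' by (intro mult_pos_pos add_nonneg_pos) auto
  have K: "0 < K" unfolding K_def using J A1 R by (simp add: A1_def add_pos_nonneg)
  have budget: "A1 + R + K * J \<le> K\<^sup>2"
  proof -
    define s where "s = sqrt (A1 + R)"
    have s: "0 \<le> s" "s\<^sup>2 = A1 + R" using A1 R by (auto simp: s_def)
    have "K = J + s" by (simp add: K_def s_def A1_def)
    then have "K\<^sup>2 - K * J = s * J + s\<^sup>2" by (simp add: power2_eq_square algebra_simps)
    moreover have "0 \<le> s * J" using s(1) J by simp
    ultimately show ?thesis using s(2) by linarith
  qed
  \<comment> \<open>By strong convexity, energy at most \<open>K\<^sup>2\<close> forces the mixed points within distance \<open>r\<close> of \<open>xstar\<close>.\<close>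
  define r where "r = sqrt (2 / \<sigma>) * K"
  have r: "0 < r" "\<sigma> / 2 * r\<^sup>2 = K\<^sup>2"
    using K sigma_pos by (auto simp: r_def power_mult_distrib)
  define q where "q = 2 * \<Lambda> * \<kappa> * r"
  have q: "0 < q" using Lam(1) kappa r by (simp add: q_def)
  \<comment> \<open>The stopping rule must be predictable; it refers to the mixed points, because the energy involves the
    gradient map \<open>d\<Phi>\<close>, about whose measurability nothing is assumed.\<close>
  define stays where "stays t \<omega> \<longleftrightarrow> (\<forall>s\<in>{1..t}. \<forall>j. N (y j s \<omega> - xstar) \<le> r)" for t \<omega>
  define v where "v i t \<omega> = (a / q) *\<^sub>R (if stays t \<omega> then y i t \<omega> - xstar else 0)" for i t \<omega>
  define w where "w i t \<omega> = dual_norm N (\<xi> i t \<omega>) / \<kappa>" for i t \<omega>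
  define c0 where "c0 = 2 * C + ln (2 * m / \<delta>)"
  have J_eq: "q * (m * c0) = K * J" by (simp add: q_def r_def J_def c0_def mult_ac)

  have x_meas: "x j s \<in> borel_measurable (Fil (t - 1))" if "1 \<le> s" "s \<le> t" for j s t
    using run'(4)[OF that(1)] by (rule measurable_from_subalg[rotated]) (use that in \<open>auto intro: sub_Fil\<close>)
  have y_meas: "y j s \<in> borel_measurable (Fil (t - 1))" if "1 \<le> s" "s \<le> t" for j s t
    using x_meas[OF that] unfolding y_def mixed_def[abs_def] by measurable
  have stays_meas: "Measurable.pred (Fil (t - 1)) (stays t)" for t
  proof -
    have "(\<lambda>\<omega>. N (y j s \<omega> - xstar)) \<in> borel_measurable (Fil (t - 1))" if "s \<in> {1..t}" for j s
    proof -
      have "(\<lambda>\<omega>. y j s \<omega> - xstar) \<in> borel_measurable (Fil (t - 1))" using y_meas[of s t j] that by simp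
      then show ?thesis by (rule measurable_compose[OF _ borel_measurable_is_norm[OF norm]])
    qed
    then show ?thesis unfolding stays_def[abs_def] by (intro pred_intros_finite) (auto intro: borel_measurable_pred_less)
  qed
  have v_meas: "v i t \<in> borel_measurable (Fil (t - 1))" if "t \<ge> 1" for i t
    unfolding v_def[abs_def] using stays_meas[of t] y_meas[of t t i] that by measurable
  have N_v: "N (v i t \<omega>) \<le> a / q * r" if "t \<ge> 1" for i t \<omega>
  proof -
    have "N (if stays t \<omega> then y i t \<omega> - xstar else 0) \<le> r"
      using that r(1) by (simp add: stays_def is_norm_zero[OF norm])
    then have "(a / q) * N (if stays t \<omega> then y i t \<omega> - xstar else 0) \<le> (a / q) * r"
      using a(1) q by (intro mult_left_mono) auto
    then show ?thesis using a(1) q by (simp add: v_def is_norm_scaleR[OF norm])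
  qed
  obtain cn where cn: "cn > 0" "\<And>x. norm x \<le> cn * N x" using norm_le_is_norm[OF norm] by blast
  have v_le: "norm (v i t \<omega>) \<le> cn * (a / q * r)" if "t \<ge> 1" for i t \<omega>
    using cn(2)[of "v i t \<omega>"] mult_left_mono[OF N_v[OF that, of i \<omega>], of cn] cn(1) by linarith
  obtain cd where cd: "cd > 0" "\<And>x. norm x \<le> cd * dual_norm N x" using norm_le_is_norm[OF D] by blast
  have w_nonneg: "0 \<le> w i t \<omega>" for i t \<omega>
    unfolding w_def using kappa by (intro divide_nonneg_pos is_norm_nonneg[OF D])
  have xi_le: "norm (\<xi> i t \<omega>) \<le> cd * \<kappa> * w i t \<omega>" for i t \<omega>
    using cd(2) kappa by (simp add: w_def)
  have w_meas: "w i t \<in> borel_measurable (Fil t)" if "t \<ge> 1" for i t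
    unfolding w_def[abs_def]
    by (intro borel_measurable_divide borel_measurable_const
        measurable_compose[OF run'(5)[OF that] borel_measurable_is_norm[OF D]])
  have noise': "AE \<omega> in M. nn_cond_exp M (Fil (t - 1)) (\<lambda>\<omega>. ennreal (exp (w i t \<omega> powr (1 / \<theta>)))) \<omega> \<le> 2"
    if "t \<ge> 1" for i t
    using noise that unfolding noise_assumption_def w_def by blast
  have exp_trunc: "(if w i t \<omega> \<le> b then exp (\<xi> i t \<omega> \<bullet> v i t \<omega>) else 0)
      \<le> 1 + \<xi> i t \<omega> \<bullet> v i t \<omega> + C * a\<^sup>2 * exp (w i t \<omega> powr (1 / \<theta>))" if "t \<ge> 1" for i t \<omega>
  proof (rule trunc[OF w_nonneg _ Lam])
    have "\<bar>\<xi> i t \<omega> \<bullet> v i t \<omega>\<bar> \<le> dual_norm N (\<xi> i t \<omega>) * N (v i t \<omega>)"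
      by (rule abs_inner_le_dual_norm[OF norm])
    also have "\<dots> \<le> dual_norm N (\<xi> i t \<omega>) * (a / q * r)"
      by (intro mult_left_mono N_v that is_norm_nonneg[OF D])
    also have "\<dots> = a / (2 * \<Lambda>) * w i t \<omega>"
      using r(1) kappa Lam(1) by (simp add: q_def w_def field_simps)
    finally show "\<bar>\<xi> i t \<omega> \<bullet> v i t \<omega>\<bar> \<le> a / (2 * \<Lambda>) * w i t \<omega>" .
  qed (use a b in auto)
  have theta0: "0 < \<theta>" using theta by simp
  have Ca: "0 \<le> C * a\<^sup>2" using C by simp
  have cdk: "0 \<le> cd * \<kappa>" using cd(1) kappa by simp
  note mart_facts = run'(1-3,5,6) v_meas v_le w_meas w_nonneg xi_le noise' theta0 Ca cdk exp_trunc
  have mart_int: "integrable M (\<lambda>\<omega>. \<Prod>t=1..T. if w i t \<omega> \<le> b then exp (\<xi> i t \<omega> \<bullet> v i t \<omega>) else 0)" for i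
    by (rule truncated_exp_martingale(1)[where Fil = Fil and \<xi> = "\<xi> i" and v = "v i" and w = "w i"
          and cv = "cn * (a / q * r)" and cw = "cd * \<kappa>" and K = "C * a\<^sup>2" and \<theta> = \<theta>]; rule mart_facts; assumption)
  have mart_le: "(\<integral>\<omega>. (\<Prod>t=1..T. if w i t \<omega> \<le> b then exp (\<xi> i t \<omega> \<bullet> v i t \<omega>) else 0) \<partial>M)
      \<le> (1 + 2 * (C * a\<^sup>2)) ^ T" for i
    by (rule truncated_exp_martingale(2)[where Fil = Fil and \<xi> = "\<xi> i" and v = "v i" and w = "w i"
          and cv = "cn * (a / q * r)" and cw = "cd * \<kappa>" and K = "C * a\<^sup>2" and \<theta> = \<theta>]; rule mart_facts; assumption)
  have "(1 + 2 * (C * a\<^sup>2)) ^ T \<le> exp (2 * (C * a\<^sup>2)) ^ T"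
    using Ca by (intro power_mono exp_ge_add_one_self) auto
  also have "\<dots> = exp (2 * C * (a\<^sup>2 * real T))" by (simp add: mult_ac flip: exp_of_nat_mult)
  finally have moment: "(1 + 2 * (C * a\<^sup>2)) ^ T \<le> exp (2 * C)" using a(3) by simp

  define Bad where "Bad i t = {\<omega> \<in> space M. b < w i t \<omega>}" for i t
  define Tail where "Tail i = {\<omega> \<in> space M. (\<forall>t\<in>{1..T}. w i t \<omega> \<le> b) \<and> c0 < (\<Sum>t=1..T. \<xi> i t \<omega> \<bullet> v i t \<omega>)}" for i
  define Good where "Good = space M - ((\<Union>i. \<Union>t\<in>{1..T}. Bad i t) \<union> (\<Union>i. Tail i))"
  have M_meas: "\<xi> i t \<in> borel_measurable M" "v i t \<in> borel_measurable M" "w i t \<in> borel_measurable M"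
    if "t \<ge> 1" for i t
    using measurable_from_subalg[OF run'(3) run'(5)[OF that]] measurable_from_subalg[OF run'(3) v_meas[OF that]]
      measurable_from_subalg[OF run'(3) w_meas[OF that]] by auto
  have Bad_sets: "Bad i t \<in> events" if "t \<in> {1..T}" for i t
  proof -
    have [measurable]: "w i t \<in> borel_measurable M" using M_meas(3)[of t i] that by simp
    show ?thesis unfolding Bad_def by measurable
  qed
  have Tail_sets: "Tail i \<in> events" for i
  proof -
    have [measurable]: "Measurable.pred M (\<lambda>\<omega>. \<forall>t\<in>{1..T}. w i t \<omega> \<le> b)"
    proof (intro pred_intros_finite)
      fix t assume "t \<in> {1..T}"
      then have [measurable]: "w i t \<in> borel_measurable M" using M_meas(3)[of t i] by simp
      show "Measurable.pred M (\<lambda>\<omega>. w i t \<omega> \<le> b)" by measurable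
    qed simp
    have [measurable]: "(\<lambda>\<omega>. \<Sum>t=1..T. \<xi> i t \<omega> \<bullet> v i t \<omega>) \<in> borel_measurable M"
      using M_meas by (intro borel_measurable_sum borel_measurable_inner) auto
    show ?thesis unfolding Tail_def by measurable
  qed
  have prob_Bad: "prob (Bad i t) \<le> \<delta> / (2 * m * real T)" if "t \<in> {1..T}" for i t
  proof -
    have t: "t \<ge> 1" using that by simp
    have "prob (Bad i t) \<le> 2 * exp (- (b powr (1 / \<theta>)))"
      unfolding Bad_def using b theta0 by (intro weibull_tail[OF run'(1) run'(3) M_meas(3)[OF t] noise'[OF t]]) auto
    also have "\<dots> = \<delta> / (2 * m * real T)"
      using delta m T by (simp add: b(2) exp_minus field_simps)
    finally show ?thesis .
  qed
  have prob_Tail: "prob (Tail i) \<le> \<delta> / (2 * m)" for i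
  proof -
    have "prob (Tail i) \<le> exp (2 * C) * exp (- c0)"
      unfolding Tail_def
      by (rule truncated_exp_martingale_tail[OF run'(1) mart_int order_trans[OF mart_le moment]])
        (use Tail_sets[of i] in \<open>simp add: Tail_def\<close>)
    also have "\<dots> = exp (- ln (2 * m / \<delta>))" by (simp add: c0_def flip: exp_add)
    also have "\<dots> = \<delta> / (2 * m)" using delta m by (simp add: exp_minus field_simps)
    finally show ?thesis .
  qed
  have Bads: "(\<Union>i. \<Union>t\<in>{1..T}. Bad i t) \<in> events" and Tails: "(\<Union>i. Tail i) \<in> events"
    using Bad_sets Tail_sets by auto
  have Good: "Good \<in> events" unfolding Good_def using Bads Tails by auto
  have "prob (\<Union>i. \<Union>t\<in>{1..T}. Bad i t) \<le> (\<Sum>i\<in>(UNIV :: 'm set). prob (\<Union>t\<in>{1..T}. Bad i t))"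
    using Bad_sets by (intro measure_UNION_le) auto
  also have "\<dots> \<le> (\<Sum>i\<in>(UNIV :: 'm set). \<Sum>t\<in>{1..T}. prob (Bad i t))"
    using Bad_sets by (intro sum_mono measure_UNION_le) auto
  also have "\<dots> \<le> (\<Sum>i\<in>(UNIV :: 'm set). \<Sum>t\<in>{1..T}. \<delta> / (2 * m * real T))"
    by (intro sum_mono prob_Bad)
  also have "\<dots> = \<delta> / 2" using T m by (simp add: m_def)
  finally have pB: "prob (\<Union>i. \<Union>t\<in>{1..T}. Bad i t) \<le> \<delta> / 2" .
  have "prob (\<Union>i. Tail i) \<le> (\<Sum>i\<in>(UNIV :: 'm set). prob (Tail i))"
    using Tail_sets by (intro measure_UNION_le) auto
  also have "\<dots> \<le> (\<Sum>i\<in>(UNIV :: 'm set). \<delta> / (2 * m))" by (intro sum_mono prob_Tail)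
  also have "\<dots> = \<delta> / 2" using m by (simp add: m_def)
  finally have pT: "prob (\<Union>i. Tail i) \<le> \<delta> / 2" .
  have "prob ((\<Union>i. \<Union>t\<in>{1..T}. Bad i t) \<union> (\<Union>i. Tail i)) \<le> \<delta>"
    using measure_Un_le[OF Bads Tails] pB pT by linarith
  then have prob_Good: "1 - \<delta> \<le> prob Good"
    unfolding Good_def using prob_compl[of "(\<Union>i. \<Union>t\<in>{1..T}. Bad i t) \<union> (\<Union>i. Tail i)"] Bads Tails by auto

  have good_bound: "gap ((1 / real T) *\<^sub>R (\<Sum>t=1..T. x l t \<omega>)) \<le> L * (1 / sqrt (real T))"
    if good: "\<omega> \<in> Good" for \<omega>
  proof -
    have om: "\<omega> \<in> space M" using good by (simp add: Good_def)
    interpret p: dcsmd_path X S N f \<psi> \<Phi> d\<Phi> xstar W B \<eta> \<sigma> G G\<psi> a T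
      "\<lambda>i t. x i t \<omega>" "\<lambda>i t. y i t \<omega>" "\<lambda>i t. g i t \<omega>" "\<lambda>i t. \<xi> i t \<omega>" by (rule path[OF om])
    have w_le: "w i t \<omega> \<le> b" if "t \<in> {1..T}" for i t
    proof -
      have "\<omega> \<notin> Bad i t" using good that unfolding Good_def by blast
      then show ?thesis using om by (simp add: Bad_def not_less)
    qed
    have level: "p.noise_level i t \<le> h" if "t \<in> {1..T}" for i t
      using w_le[OF that, of i] kappa by (simp add: p.noise_level_def h_def w_def field_simps)
    have sum_le: "(\<Sum>t=1..T. \<xi> i t \<omega> \<bullet> v i t \<omega>) \<le> c0" for i
    proof -
      have "\<omega> \<notin> Tail i" using good by (auto simp: Good_def)
      then show ?thesis using om w_le by (auto simp: Tail_def)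
    qed
    have x_start: "(\<lambda>i. x i 1 \<omega>) = x1" using run'(7)[OF om] by auto
    have energy1: "p.energy 1 = A1" using run'(7)[OF om] by (simp add: p.energy_def A1_def)
    have "q * (\<Sum>i\<in>UNIV. \<Sum>t=1..T. \<xi> i t \<omega> \<bullet> v i t \<omega>) \<le> q * (\<Sum>i\<in>(UNIV :: 'm set). c0)"
      using q by (intro mult_left_mono sum_mono sum_le) auto
    also have "\<dots> = K * J" using J_eq by (simp add: m_def)
    finally have "q * (\<Sum>i\<in>UNIV. \<Sum>t=1..T. \<xi> i t \<omega> \<bullet> v i t \<omega>) \<le> K * J" .
    moreover have "q * (\<Sum>i\<in>UNIV. \<Sum>t=1..T. \<xi> i t \<omega> \<bullet> v i t \<omega>)
        = a * (\<Sum>t=1..T. \<Sum>i\<in>UNIV. if stays t \<omega> then \<xi> i t \<omega> \<bullet> (y i t \<omega> - xstar) else 0)"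
    proof -
      have "q * (\<xi> i t \<omega> \<bullet> v i t \<omega>) = a * (if stays t \<omega> then \<xi> i t \<omega> \<bullet> (y i t \<omega> - xstar) else 0)" for i t
        using q by (simp add: v_def)
      then show ?thesis unfolding sum_distrib_left by (subst sum.swap) simp
    qed
    ultimately have stopped: "a * (\<Sum>t=1..T. \<Sum>i\<in>UNIV. if stays t \<omega> then \<xi> i t \<omega> \<bullet> (y i t \<omega> - xstar) else 0) \<le> K * J"
      by simp
    have "a * (\<Sum>t=1..T. gap (x l t \<omega>)) \<le> K\<^sup>2"
    proof (rule p.stopped_noise_bound_imp_no_exit[OF _ stays_def r(2) _ stopped])
      show "p.energy (Suc \<tau>) + a * (\<Sum>t=1..\<tau>. gap (x l t \<omega>))
          \<le> p.energy 1 + a * (\<Sum>t=1..\<tau>. \<Sum>i\<in>UNIV. \<xi> i t \<omega> \<bullet> (y i t \<omega> - xstar)) + R" if "\<tau> \<le> T" for \<tau>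
        using p.energy_inequality_of_noise_bound[OF consensus c level h _ a(2) that, of l] a(3)
        unfolding x_start R_def m_def by simp
      show "p.energy 1 + R + K * J \<le> K\<^sup>2" using budget energy1 by simp
    qed (use r(1) in simp)
    then have "real T * a * ((1 / real T) * (\<Sum>t=1..T. gap (x l t \<omega>))) \<le> K\<^sup>2"
      using T by simp
    moreover have "gap ((1 / real T) *\<^sub>R (\<Sum>t=1..T. x l t \<omega>)) \<le> (1 / real T) * (\<Sum>t=1..T. gap (x l t \<omega>))"
      using T p.x_in_X by (intro gap_average_le) auto
    moreover have "real T * a = sqrt (real T)" using T by (simp add: a_def real_div_sqrt)
    ultimately have "sqrt (real T) * gap ((1 / real T) *\<^sub>R (\<Sum>t=1..T. x l t \<omega>)) \<le> L"
      using mult_left_mono[of "gap ((1 / real T) *\<^sub>R (\<Sum>t=1..T. x l t \<omega>))"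
          "(1 / real T) * (\<Sum>t=1..T. gap (x l t \<omega>))" "sqrt (real T)"] L by simp
    then show ?thesis using T by (simp add: field_simps)
  qed

  have avg_in: "(1 / real T) *\<^sub>R (\<Sum>t=1..T. x l t \<omega>) \<in> X \<inter> interior S" if "\<omega> \<in> space M" for \<omega>
  proof -
    interpret p: dcsmd_path X S N f \<psi> \<Phi> d\<Phi> xstar W B \<eta> \<sigma> G G\<psi> a T
      "\<lambda>i t. x i t \<omega>" "\<lambda>i t. y i t \<omega>" "\<lambda>i t. g i t \<omega>" "\<lambda>i t. \<xi> i t \<omega>" by (rule path[OF that])
    have "convex (X \<inter> interior S)" using X_convex S_convex by (intro convex_Int convex_interior)
    then have "(\<Sum>t=1..T. (1 / real T) *\<^sub>R x l t \<omega>) \<in> X \<inter> interior S"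
      using T p.x_in_X p.x_interior by (intro convex_sum) auto
    then show ?thesis by (simp only: scaleR_right.sum)
  qed
  have "(\<lambda>\<omega>. (1 / real T) *\<^sub>R (\<Sum>t=1..T. x l t \<omega>)) \<in> borel_measurable M"
    using measurable_from_subalg[OF run'(3) run'(4)] by (intro borel_measurable_scaleR borel_measurable_sum) auto
  then have "(\<lambda>\<omega>. (1 / real T) *\<^sub>R (\<Sum>t=1..T. x l t \<omega>)) \<in> M \<rightarrow>\<^sub>M restrict_space borel (X \<inter> interior S)"
    using avg_in by (intro measurable_restrict_space2) auto
  then have "(\<lambda>\<omega>. gap ((1 / real T) *\<^sub>R (\<Sum>t=1..T. x l t \<omega>))) \<in> borel_measurable M"
    by (rule measurable_compose[OF _ borel_measurable_continuous_on_restrict[OF continuous_on_gap]])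
  then have "{\<omega> \<in> space M. gap ((1 / real T) *\<^sub>R (\<Sum>t=1..T. x l t \<omega>)) \<le> L * (1 / sqrt (real T))} \<in> events"
    by measurable
  then have "prob Good \<le> prob {\<omega> \<in> space M. gap ((1 / real T) *\<^sub>R (\<Sum>t=1..T. x l t \<omega>)) \<le> L * (1 / sqrt (real T))}"
    using good_bound by (intro finite_measure_mono) (auto simp: Good_def)
  with prob_Good show ?thesis by linarith
qed

end

section \<open>The convergence rate\<close>

text \<open>
  The quantities \<open>b\<close> and \<open>h\<close> are of order \<open>ln (T / \<delta>) powr \<theta>\<close>, and \<open>R\<close> is of the order of its square.  For \<open>\<theta> < 1\<close> the factor \<open>\<Lambda>\<close> is \<open>1\<close>,
  and \<open>J\<close> is of order \<open>1 + ln (1 / \<delta>)\<close>: its square is the additional term in the rate.  For \<open>\<theta> \<ge> 1\<close> the factor \<open>\<Lambda>\<close> is of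
  order \<open>ln (T / \<delta>) powr (\<theta> - 1)\<close>, and \<open>J\<close> is of order \<open>ln (T / \<delta>) powr \<theta>\<close>, so that \<open>R\<close> and \<open>J\<^sup>2\<close> have the same order.
\<close>

lemma rate_bound:
  fixes m A s c C G\<^sub>1 G\<^sub>2 \<kappa> \<sigma> \<theta> :: real
  assumes m: "1 \<le> m" and nonneg: "0 \<le> A" "0 \<le> s" "0 \<le> c" "0 \<le> C" "0 \<le> G\<^sub>1" "0 \<le> G\<^sub>2"
    and pos: "0 < \<kappa>" "0 < \<sigma>" and theta: "1 / 2 \<le> \<theta>"
  shows "\<exists>C'>0. \<forall>T \<delta>. 10 \<le> T \<longrightarrow> 0 < \<delta> \<longrightarrow> \<delta> < 1 \<longrightarrow>
     (energy_radius m A s c C G\<^sub>1 G\<^sub>2 \<kappa> \<sigma> \<theta> T \<delta>)\<^sup>2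
       \<le> C' * (if \<theta> < 1 then ln (T / \<delta>) powr (2 * \<theta>) + (ln (1 / \<delta>))\<^sup>2 else ln (T / \<delta>) powr (2 * \<theta>))"
proof -
  define c1 where "c1 = 1 + ln (4 * m)"
  define c2 where "c2 = G\<^sub>1 + \<kappa> * c1 powr \<theta>"
  define c3 where "c3 = m * c2\<^sup>2 / \<sigma> + G\<^sub>2 * m * c * (s + m * c2 / \<sigma>)"
  define c4 where "c4 = 2 * \<kappa> * sqrt (2 / \<sigma>) * m"
  define c5 where "c5 = 1 + 2 * C + ln (2 * m)"
  define c6 where "c6 = c4 * c5 * c1 powr \<theta>"
  define C' where "C' = 8 * c6\<^sup>2 + 2 * (A + c3) + 1"
  have c1: "1 \<le> c1" using m by (simp add: c1_def)
  have c1p: "1 \<le> c1 powr \<theta>" using c1 theta by (intro ge_one_powr_ge_zero) auto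
  have c2: "0 \<le> c2" using nonneg pos by (simp add: c2_def)
  have c3: "0 \<le> c3"
    unfolding c3_def using m nonneg pos c2
    by (intro add_nonneg_nonneg mult_nonneg_nonneg divide_nonneg_pos) auto
  have c4: "0 \<le> c4" using m pos by (simp add: c4_def)
  have c5: "1 \<le> c5" using m nonneg by (simp add: c5_def)
  have C'_pos: "0 < C'" unfolding C'_def using nonneg c3 by (simp add: add_nonneg_pos)
  have main: "(energy_radius m A s c C G\<^sub>1 G\<^sub>2 \<kappa> \<sigma> \<theta> T \<delta>)\<^sup>2
       \<le> C' * (if \<theta> < 1 then ln (T / \<delta>) powr (2 * \<theta>) + (ln (1 / \<delta>))\<^sup>2 else ln (T / \<delta>) powr (2 * \<theta>))"
    if T: "10 \<le> T" and delta: "0 < \<delta>" "\<delta> < 1" for T \<delta>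
  proof -
    define b where b: "b = ln (4 * m * T / \<delta>) powr \<theta>"
    define \<Lambda> where Lam: "\<Lambda> = max 1 (b powr (1 - 1 / \<theta>))"
    define h where h: "h = G\<^sub>1 + \<kappa> * b"
    define R where R: "R = m * h\<^sup>2 / \<sigma> + G\<^sub>2 * m * c * (s + m * h / \<sigma>)"
    define J where J: "J = 2 * \<Lambda> * \<kappa> * sqrt (2 / \<sigma>) * m * (2 * C + ln (2 * m / \<delta>))"
    have radius: "energy_radius m A s c C G\<^sub>1 G\<^sub>2 \<kappa> \<sigma> \<theta> T \<delta> = J + sqrt (A + R)"
      unfolding energy_radius_def Let_def b Lam h R J ..
    define H where "H = ln (T / \<delta>)"
    define d where "d = ln (1 / \<delta>)"
    have d: "0 \<le> d" using delta by (simp add: d_def)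
    have H_eq: "H = ln T + d" using T delta by (simp add: H_def d_def ln_div)
    \<comment> \<open>Since \<open>H \<ge> 1\<close>, additive constants can be absorbed into multiples of \<open>H\<close>.\<close>
    have "1 \<le> ln T"
    proof -
      have "exp 1 \<le> T" using exp_le T by linarith
      then show ?thesis using T by (simp add: ln_ge_iff)
    qed
    then have H: "1 \<le> H" "1 + d \<le> 2 * H" using d by (auto simp: H_eq)
    define HT where "HT = H powr \<theta>"
    have HT: "1 \<le> HT" unfolding HT_def using H theta by (intro ge_one_powr_ge_zero) auto
    have H2: "H powr (2 * \<theta>) = HT\<^sup>2" by (simp add: HT_def power2_eq_square flip: powr_add)
    define L where "L = ln (4 * m * T / \<delta>)"
    have L_eq: "L = ln (4 * m) + H"
      using m T delta by (simp add: L_def H_def ln_mult ln_div)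
    have ln4m: "0 \<le> ln (4 * m)" using m by (intro ln_ge_zero) simp
    have "ln (4 * m) * 1 \<le> ln (4 * m) * H" using H(1) ln4m by (rule mult_left_mono)
    then have L: "1 \<le> L" "L \<le> c1 * H" using H(1) ln4m by (simp_all add: L_eq c1_def distrib_right)
    have "b \<le> (c1 * H) powr \<theta>"
      unfolding b L_def[symmetric] using L theta by (intro powr_mono2) auto
    also have "\<dots> = c1 powr \<theta> * HT" using c1 H by (simp add: HT_def powr_mult)
    finally have b_le: "b \<le> c1 powr \<theta> * HT" .
    have b1: "1 \<le> b" unfolding b L_def[symmetric] using L theta by (intro ge_one_powr_ge_zero) auto
    have "\<kappa> * b \<le> \<kappa> * (c1 powr \<theta> * HT)" using b_le pos by (intro mult_left_mono) auto
    moreover have "G\<^sub>1 * 1 \<le> G\<^sub>1 * HT" using HT nonneg by (intro mult_left_mono) auto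
    ultimately have h_le: "h \<le> c2 * HT" by (simp add: h c2_def distrib_right mult.assoc)
    have h0: "0 \<le> h" using b1 nonneg pos by (simp add: h)
    have HT2: "HT \<le> HT\<^sup>2" using HT by (simp add: power2_eq_square)
    have R_le: "R \<le> c3 * HT\<^sup>2"
    proof -
      have "h\<^sup>2 \<le> (c2 * HT)\<^sup>2" by (intro power_mono h_le h0)
      then have "m * h\<^sup>2 / \<sigma> \<le> m * (c2 * HT)\<^sup>2 / \<sigma>"
        using m pos by (intro divide_right_mono mult_left_mono) auto
      also have "\<dots> = m * c2\<^sup>2 / \<sigma> * HT\<^sup>2" by (simp add: power_mult_distrib)
      finally have 1: "m * h\<^sup>2 / \<sigma> \<le> m * c2\<^sup>2 / \<sigma> * HT\<^sup>2" .
      have "h \<le> c2 * HT\<^sup>2" using h_le mult_left_mono[OF HT2 c2] by linarith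
      then have "m * h / \<sigma> \<le> m * (c2 * HT\<^sup>2) / \<sigma>"
        using m pos by (intro divide_right_mono mult_left_mono) auto
      moreover have "s * 1 \<le> s * HT\<^sup>2" using HT nonneg by (intro mult_left_mono) auto
      ultimately have "s + m * h / \<sigma> \<le> (s + m * c2 / \<sigma>) * HT\<^sup>2" by (simp add: distrib_right)
      then have "G\<^sub>2 * m * c * (s + m * h / \<sigma>) \<le> G\<^sub>2 * m * c * ((s + m * c2 / \<sigma>) * HT\<^sup>2)"
        using m nonneg by (intro mult_left_mono) auto
      with 1 show ?thesis by (simp add: R c3_def distrib_right mult.assoc)
    qed
    have R0: "0 \<le> R"
      unfolding R using m nonneg pos h0
      by (intro add_nonneg_nonneg mult_nonneg_nonneg divide_nonneg_pos) auto
    have "A * 1 \<le> A * HT\<^sup>2" using HT nonneg by (intro mult_left_mono) auto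
    then have AR: "A + R \<le> (A + c3) * HT\<^sup>2" using R_le by (simp add: distrib_right)
    have "2 * C + ln (2 * m / \<delta>) = 2 * C + ln (2 * m) + d"
      using m delta by (simp add: d_def ln_div)
    also have "\<dots> \<le> c5 * (1 + d)"
    proof -
      have "1 * d \<le> c5 * d" using c5 d by (intro mult_right_mono) auto
      then show ?thesis using m by (simp add: c5_def distrib_left)
    qed
    finally have log_le: "2 * C + ln (2 * m / \<delta>) \<le> c5 * (1 + d)" .
    have "0 \<le> ln (2 * m / \<delta>)" using m delta by (intro ln_ge_zero) (simp add: field_simps)
    then have log0: "0 \<le> 2 * C + ln (2 * m / \<delta>)" using nonneg by simp
    have Lam1: "1 \<le> \<Lambda>" by (simp add: Lam)
    have J_eq: "J = \<Lambda> * (c4 * (2 * C + ln (2 * m / \<delta>)))" by (simp add: J c4_def mult_ac)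
    have J0: "0 \<le> J" unfolding J_eq using Lam1 c4 log0 by simp
    have c45: "c4 * (2 * C + ln (2 * m / \<delta>)) \<le> c4 * (c5 * (1 + d))"
      by (intro mult_left_mono log_le c4)
    have split: "(J + sqrt (A + R))\<^sup>2 \<le> 2 * J\<^sup>2 + 2 * ((A + c3) * HT\<^sup>2)"
    proof -
      have "0 \<le> (J - sqrt (A + R))\<^sup>2" by simp
      then have "(J + sqrt (A + R))\<^sup>2 \<le> 2 * J\<^sup>2 + 2 * (sqrt (A + R))\<^sup>2"
        by (simp add: power2_eq_square algebra_simps)
      then show ?thesis using AR R0 nonneg by simp
    qed
    have c45': "c4 * c5 \<le> c6" unfolding c6_def using c4 c5 mult_left_mono[OF c1p, of "c4 * c5"] by simp
    have c6: "0 \<le> c6" using c45' c4 c5 mult_nonneg_nonneg[of c4 c5] by linarith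
    show ?thesis
    proof (cases "\<theta> < 1")
      case True
      have "b powr (1 - 1 / \<theta>) \<le> b powr 0" using b1 True theta by (intro powr_mono) auto
      then have "\<Lambda> = 1" using b1 by (simp add: Lam)
      then have "J \<le> c4 * c5 * (1 + d)" using c45 by (simp add: J_eq mult.assoc)
      also have "\<dots> \<le> c6 * (1 + d)" using c45' d by (intro mult_right_mono) auto
      finally have "J\<^sup>2 \<le> (c6 * (1 + d))\<^sup>2" using J0 by (intro power_mono) auto
      also have "\<dots> = c6\<^sup>2 * (1 + d)\<^sup>2" by (simp add: power_mult_distrib)
      also have "\<dots> \<le> c6\<^sup>2 * (4 * (HT\<^sup>2 + d\<^sup>2))"
      proof (intro mult_left_mono)
        have "0 \<le> (1 - d)\<^sup>2" by simp
        then have "(1 + d)\<^sup>2 \<le> 2 + 2 * d\<^sup>2" by (simp add: power2_eq_square algebra_simps)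
        also have "\<dots> \<le> 4 * HT\<^sup>2 + 4 * d\<^sup>2"
        proof (rule add_mono)
          have "1 \<le> HT\<^sup>2" using HT by (rule one_le_power)
          then show "2 \<le> 4 * HT\<^sup>2" by linarith
        qed simp
        finally show "(1 + d)\<^sup>2 \<le> 4 * (HT\<^sup>2 + d\<^sup>2)" by simp
      qed simp
      finally have J2: "J\<^sup>2 \<le> 4 * c6\<^sup>2 * (HT\<^sup>2 + d\<^sup>2)"
        by (simp only: mult_ac)
      have "(A + c3) * HT\<^sup>2 \<le> (A + c3) * (HT\<^sup>2 + d\<^sup>2)"
        using nonneg c3 by (intro mult_left_mono) auto
      then have "2 * J\<^sup>2 + 2 * ((A + c3) * HT\<^sup>2) \<le> 2 * (4 * c6\<^sup>2 * (HT\<^sup>2 + d\<^sup>2)) + 2 * ((A + c3) * (HT\<^sup>2 + d\<^sup>2)) + (HT\<^sup>2 + d\<^sup>2)"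
        using J2 zero_le_power2[of HT] zero_le_power2[of d] by linarith
      also have "\<dots> = C' * (HT\<^sup>2 + d\<^sup>2)" by (simp add: C'_def algebra_simps)
      finally show ?thesis using split True by (simp add: radius H2 H_def[symmetric] d_def[symmetric])
    next
      case False
      have "b powr (1 - 1 / \<theta>) = L powr (\<theta> - 1)"
        using theta by (simp add: b L_def[symmetric] powr_powr right_diff_distrib)
      also have "\<dots> \<le> (c1 * H) powr (\<theta> - 1)" using L False by (intro powr_mono2) auto
      also have "\<dots> = c1 powr (\<theta> - 1) * H powr (\<theta> - 1)" using c1 H by (simp add: powr_mult)
      also have "\<dots> \<le> c1 powr \<theta> * H powr (\<theta> - 1)" using c1 by (intro mult_right_mono powr_mono) auto
      finally have "b powr (1 - 1 / \<theta>) \<le> c1 powr \<theta> * H powr (\<theta> - 1)" .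
      moreover have "1 * 1 \<le> c1 powr \<theta> * H powr (\<theta> - 1)"
        using c1 theta H False by (intro mult_mono ge_one_powr_ge_zero) auto
      ultimately have Lam_le: "\<Lambda> \<le> c1 powr \<theta> * H powr (\<theta> - 1)" by (simp add: Lam)
      have "c4 * (2 * C + ln (2 * m / \<delta>)) \<le> c4 * (c5 * (2 * H))"
        using c45 H(2) c4 c5 mult_left_mono[of "c5 * (1 + d)" "c5 * (2 * H)" c4] mult_left_mono[of "1 + d" "2 * H" c5]
        by linarith
      then have "J \<le> (c1 powr \<theta> * H powr (\<theta> - 1)) * (c4 * (c5 * (2 * H)))"
        unfolding J_eq by (rule mult_mono[OF Lam_le]) (use c4 log0 in auto)
      also have "\<dots> = 2 * c6 * (H powr (\<theta> - 1) * H powr 1)" using H by (simp add: c6_def)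
      also have "H powr (\<theta> - 1) * H powr 1 = HT"
        unfolding HT_def by (subst powr_add[symmetric]) simp
      finally have "J\<^sup>2 \<le> (2 * c6 * HT)\<^sup>2" using J0 by (intro power_mono) auto
      then have "J\<^sup>2 \<le> 4 * c6\<^sup>2 * HT\<^sup>2" by (simp add: power_mult_distrib)
      then have "2 * J\<^sup>2 + 2 * ((A + c3) * HT\<^sup>2) \<le> 2 * (4 * c6\<^sup>2 * HT\<^sup>2) + 2 * ((A + c3) * HT\<^sup>2) + HT\<^sup>2"
        using zero_le_power2[of HT] by linarith
      also have "\<dots> = C' * HT\<^sup>2" by (simp add: C'_def algebra_simps)
      finally show ?thesis using split False by (simp add: radius H2 H_def[symmetric])
    qed
  qed
  show ?thesis
  proof (intro exI[of _ C'] conjI allI impI)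
    show "0 < C'" by (rule C'_pos)
  qed (rule main)
qed

theorem theorem4:
  fixes X S :: "(real ^ 'n) set"
    and N :: "real ^ 'n \<Rightarrow> real"
    and f \<psi> :: "'m::finite \<Rightarrow> real ^ 'n \<Rightarrow> real"
    and F :: "real ^ 'n \<Rightarrow> real"
    and \<Phi> :: "real ^ 'n \<Rightarrow> real"
    and d\<Phi> :: "real ^ 'n \<Rightarrow> real ^ 'n"
    and xstar :: "real ^ 'n"
    and W :: "nat \<Rightarrow> real ^ 'm ^ 'm"
    and x1 :: "'m \<Rightarrow> real ^ 'n"
    and B :: nat
    and \<eta> \<sigma> G G\<psi> \<kappa> \<theta> :: real
  assumes "is_norm N"
    and "closed X" and "convex X"
    and "X \<subseteq> S" and "\<And>i. convex_on S (f i)" and "\<And>i. convex_on X (\<psi> i)"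
    and "F = (\<lambda>z. (\<Sum>i\<in>UNIV. f i z) + (\<Sum>i\<in>UNIV. \<psi> i z))"
    and "xstar \<in> X" and "\<And>z. z \<in> X \<Longrightarrow> F z \<ge> F xstar"
    and "\<And>i. x1 i \<in> X"
    and "network_assumption W B \<eta>"
    and "bounded_assumption X S N f \<psi> G G\<psi>"
    and "bregman_assumption TYPE('m) X N \<Phi> d\<Phi> \<sigma>"
    and "1 / 2 \<le> \<theta>" and "0 < \<kappa>"
  shows "\<exists>C>0. \<forall>T\<ge>10. \<forall>(\<alpha> :: nat \<Rightarrow> real) (M :: 'w measure) Fil x g \<xi>.
    (\<forall>t\<ge>1. 0 < \<alpha> t) \<longrightarrow> (\<forall>t\<in>{1..T}. \<alpha> t = 1 / sqrt (real T)) \<longrightarrow>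
    dcsmd_sw_run X S f \<psi> \<Phi> d\<Phi> W x1 \<alpha> M Fil x g \<xi> \<longrightarrow>
    noise_assumption M Fil N \<xi> \<theta> \<kappa> \<longrightarrow>
    (\<forall>l. \<forall>\<delta>. 0 < \<delta> \<longrightarrow> \<delta> < 1 \<longrightarrow>
      measure M {\<omega> \<in> space M.
        F ((1 / real T) *\<^sub>R (\<Sum>t=1..T. x l t \<omega>)) - F xstar \<le>
          C * ((if \<theta> < 1 then ln (real T / \<delta>) powr (2 * \<theta>) + (ln (1 / \<delta>))\<^sup>2
                else ln (real T / \<delta>) powr (2 * \<theta>)) * (1 / sqrt (real T)))}
      \<ge> 1 - \<delta>)"
proof -
  interpret dcsmd_problem X S N f \<psi> \<Phi> d\<Phi> xstar W B \<eta> \<sigma> G G\<psi>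
  proof
    show "(\<Sum>i\<in>UNIV. f i xstar + \<psi> i xstar) \<le> (\<Sum>i\<in>UNIV. f i z + \<psi> i z)" if "z \<in> X" for z
      using assms(9)[OF that] by (simp add: assms(7) sum.distrib)
  qed (use assms in auto)
  have gap_eq: "F z - F xstar = gap z" for z by (simp add: assms(7) sum.distrib)
  obtain c where c: "c > 0" "\<forall>(z :: nat \<Rightarrow> 'm \<Rightarrow> real ^ 'n) e T.
       (\<forall>t\<ge>1. \<forall>i. N (z (Suc t) i - (\<Sum>j\<in>UNIV. W t $ i $ j *\<^sub>R z t j)) \<le> e t) \<longrightarrow>
       (\<Sum>t=1..T. spread N (z t)) \<le> c * (spread N (z 1) + (\<Sum>t=1..T. e t))"
    using consensus_spread_sum[OF network norm] by (elim exE conjE)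
  obtain C where C: "C \<ge> 0" "\<forall>w b \<Lambda> \<beta> u. 0 \<le> w \<longrightarrow> 0 \<le> b \<longrightarrow> 1 \<le> \<Lambda> \<longrightarrow> (1 \<le> \<theta> \<longrightarrow> b powr (1 - 1 / \<theta>) \<le> \<Lambda>) \<longrightarrow>
       0 \<le> \<beta> \<longrightarrow> \<beta> \<le> 1 \<longrightarrow> \<bar>u\<bar> \<le> \<beta> / (2 * \<Lambda>) * w \<longrightarrow>
       (if w \<le> b then exp u else 0) \<le> 1 + u + C * \<beta>\<^sup>2 * exp (w powr (1 / \<theta>))"
    using truncated_exp_le[OF assms(14)] by (elim exE conjE)
  let ?A = "\<Sum>i\<in>UNIV. bregman \<Phi> d\<Phi> xstar (x1 i)"
  let ?rate = "\<lambda>T \<delta>. if \<theta> < 1 then ln (real T / \<delta>) powr (2 * \<theta>) + (ln (1 / \<delta>))\<^sup>2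
                else ln (real T / \<delta>) powr (2 * \<theta>)"
  have m: "1 \<le> real CARD('m)" by (simp add: Suc_leI)
  have A: "0 \<le> ?A" by (intro sum_nonneg bregman_nonneg[OF bregman xstar assms(10)])
  have c0: "0 \<le> c" "0 \<le> C" "0 \<le> G + G\<psi>" "0 \<le> 2 * G + G\<psi>" using c C G_pos Gpsi_pos by auto
  obtain C' where C': "C' > 0" "\<forall>T \<delta>. 10 \<le> T \<longrightarrow> 0 < \<delta> \<longrightarrow> \<delta> < 1 \<longrightarrow>
      (energy_radius (real CARD('m)) ?A (spread N x1) c C (G + G\<psi>) (2 * G + G\<psi>) \<kappa> \<sigma> \<theta> T \<delta>)\<^sup>2
        \<le> C' * (if \<theta> < 1 then ln (T / \<delta>) powr (2 * \<theta>) + (ln (1 / \<delta>))\<^sup>2 else ln (T / \<delta>) powr (2 * \<theta>))"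
    using rate_bound[OF m A spread_nonneg[OF norm, of x1] c0 assms(15) sigma_pos assms(14)] by (elim exE conjE)
  show ?thesis
  proof (intro exI[of _ C'] conjI allI impI)
    fix T :: nat and \<alpha> :: "nat \<Rightarrow> real" and M :: "'w measure" and Fil x g \<xi> l and \<delta> :: real
    assume T: "10 \<le> T" and alpha: "\<forall>t\<in>{1..T}. \<alpha> t = 1 / sqrt (real T)"
      and run: "dcsmd_sw_run X S f \<psi> \<Phi> d\<Phi> W x1 \<alpha> M Fil x g \<xi>"
      and noise: "noise_assumption M Fil N \<xi> \<theta> \<kappa>" and delta: "0 < \<delta>" "\<delta> < 1"
    have "1 - \<delta> \<le> measure M {\<omega> \<in> space M.
        gap ((1 / real T) *\<^sub>R (\<Sum>t=1..T. x l t \<omega>)) \<le> (C' * ?rate T \<delta>) * (1 / sqrt (real T))}"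
    proof (rule high_probability_bound[OF assms(10) _ _ run noise assms(14,15) delta c(2)[rule_format] c0(1,2) C(2)[rule_format]])
      show "(energy_radius (real CARD('m)) ?A (spread N x1) c C (G + G\<psi>) (2 * G + G\<psi>) \<kappa> \<sigma> \<theta> (real T) \<delta>)\<^sup>2
          \<le> C' * ?rate T \<delta>"
        using T by (intro C'(2)[rule_format] delta) simp
    qed (use T alpha in auto)
    then show "1 - \<delta> \<le> measure M {\<omega> \<in> space M.
        F ((1 / real T) *\<^sub>R (\<Sum>t=1..T. x l t \<omega>)) - F xstar \<le> C' * (?rate T \<delta> * (1 / sqrt (real T)))}"
      unfolding gap_eq by (simp only: mult.assoc)
  qed (rule C')
qed

end
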